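(* Let $B=\{\mathbf x^{\beta_1},\dots,\mathbf x^{\beta_r}\}\subset\mathbb C[\mathbf x]$ be a set of monomials closed under division with $|B|=r$ and $o=\deg(B)$, and let $\mathcal D\subset\mathbb C[\mathbf d]_{r-1}$ be a linear subspace of dimension $r$. The following points are equivalent: 1. $\mathcal D\in\mathrm{Hilb}_r$ and $B_t$ is a basis of $\mathbb C[\mathbf x]/(\mathcal D^\perp+\mathfrak m^{t+1})$ for $t=1,\dots,o$. 2. $\mathcal D$ has a basis $\mathbf\Lambda=\{\Lambda_1,\dots,\Lambda_r\}$ dual to $B$ which, writing $\Lambda_i=\sum_{|\alpha|<r}\mu_{\beta_i,\alpha}\,\mathbf d^\alpha/\alpha!$, satisfies $\Lambda_1=1$ and the equations $$\Lambda_i=\sum_{|\beta_j|<|\beta_i|}\ \sum_{k=1}^n\mu_{\beta_i,\beta_j+e_k}\,I_k(\Lambda_j)\qquad(i=2,\dots,r),$$ $$\sum_{j:\,|\beta_s|<|\beta_j|<|\beta_i|}\big(\mu_{\beta_i,\beta_j+e_k}\,\mu_{\beta_j,\beta_s+e_l}-\mu_{\beta_i,\beta_j+e_l}\,\mu_{\beta_j,\beta_s+e_k}\big)=0$$ for all $i,s\in\{1,\dots,r\}$ with $|\beta_s|<|\beta_i|$ and all $k\ne l$ in $\{1,\dots,n\}$, and, for all $i,j,k$ with $|\beta_j|<|\beta_i|$, $$\mu_{\beta_i,\beta_j+e_k}=\begin{cases}1&\text{if }\beta_i=\beta_j+e_k,\\0&\text{if }\beta_j+e_k\in E,\ \bet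a_i\ne\beta_j+e_k.\end{cases}$$
   Context: $\mathbf x=(x_1,\dots,x_n)$, $\mathfrak m=(x_1,\dots,x_n)$, $\mathbf d=(d_1,\dots,d_n)$; $\mathbb C[\mathbf d]_t$ is the space of polynomials in $\mathbf d$ of degree $\le t$; $e_1,\dots,e_n$ is the standard basis of $\mathbb N^n$. Elements of $\mathbb C[\mathbf d]$ act as functionals on $\mathbb C[\mathbf x]$ by $\mathbf d^\beta(p)=\partial^{|\beta|}p/\partial\mathbf x^\beta(0)$. $\mathcal D^\perp=\{p\in\mathbb C[\mathbf x]:\Lambda(p)=0\ \forall\Lambda\in\mathcal D\}$. $\mathbf\Lambda$ dual to $B$ means $\Lambda_i(\mathbf x^{\beta_j})=\delta_{ij}$. $E=\{\beta_1,\dots,\beta_r\}$, ordered by increasing degree, $\beta_1=0$. $B$ is closed under division if $\beta\in E$ with positive $k$-th entry implies $\beta-e_k\in E$. $B_t$ is the set of monomials of $B$ of degree $\le t$. $\mathrm{Hilb}_r$ (the punctual Hilbert scheme of points of multiplicity $r$) is the set of $r$-dimensional linear subspaces $\mathcal D\subset\mathbb C[\mathbf d]_{r-1}$ with $\partial_{d_k}\mathcal D\subset\mathcal D$ for $k=1,\dots,n$. For $\Lambda\in\mathbb C[\mathbf d]$, $I_k(\Lambda)$ denotes the unique polynomial divisible by $d_k$ with $\partial_{d_k}I_k(\Lambda)=\Lambda(d_1,\dots,d_k,0,\dots,0)$. *)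

theory Defs
  imports Complex_Main "HOL-Library.Poly_Mapping"
begin

abbreviation "lookup \<equiv> Poly_Mapping.lookup"
abbreviation "keys \<equiv> Poly_Mapping.keys"

text \<open>
  The finite linearly ordered type \<open>'n\<close> indexes the \<open>n\<close> variables; the order is needed because
  \<open>integ k\<close> below treats the variables before and after the \<open>k\<close>-th one differently.
  The same type represents \<open>\<complex>[\<^bold>x]\<close> and its space of functionals \<open>\<complex>[\<^bold>d]\<close>.
\<close>

type_synonym 'n expo = "'n \<Rightarrow>\<^sub>0 nat"
type_synonym 'n cpoly = "'n expo \<Rightarrow>\<^sub>0 complex"

definition ev :: "'n \<Rightarrow> 'n expo" where
  "ev k = Poly_Mapping.single k 1"

definition mdeg :: "'n::finite expo \<Rightarrow> nat" where
  "mdeg \<alpha> = (\<Sum>k\<in>UNIV. lookup \<alpha> k)"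

definition mfact :: "'n::finite expo \<Rightarrow> complex" where
  "mfact \<alpha> = (\<Prod>k\<in>UNIV. fact (lookup \<alpha> k))"

definition mon :: "'n expo \<Rightarrow> 'n cpoly" where
  "mon \<alpha> = Poly_Mapping.single \<alpha> 1"

definition var :: "'n \<Rightarrow> 'n cpoly" where
  "var k = mon (ev k)"

definition cscale :: "complex \<Rightarrow> 'n cpoly \<Rightarrow> 'n cpoly" where
  "cscale c p = Poly_Mapping.single 0 c * p"

interpretation cpoly: vector_space "cscale :: complex \<Rightarrow> 'n cpoly \<Rightarrow> 'n cpoly"
  by unfold_locales
    (simp_all add: cscale_def distrib_left distrib_right single_add mult_single flip: mult.assoc)

definition cpoly_upto :: "nat \<Rightarrow> 'n::finite cpoly set" where
  "cpoly_upto t = {p. \<forall>\<alpha>\<in>keys p. mdeg \<alpha> \<le> t}"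

definition peval :: "('n::finite \<Rightarrow> complex) \<Rightarrow> 'n cpoly \<Rightarrow> complex" where
  "peval a p = (\<Sum>\<alpha>\<in>keys p. lookup p \<alpha> * (\<Prod>k\<in>UNIV. a k ^ lookup \<alpha> k))"

text \<open>
  Formal partial derivative. Subtraction of exponents is truncated, but terms with
  \<open>lookup \<alpha> k = 0\<close> have coefficient \<open>0\<close>.
\<close>

definition pdiff :: "'n \<Rightarrow> 'n cpoly \<Rightarrow> 'n cpoly" where
  "pdiff k p =
    (\<Sum>\<alpha>\<in>keys p. Poly_Mapping.single (\<alpha> - ev k) (of_nat (lookup \<alpha> k) * lookup p \<alpha>))"

definition pdiffs :: "'n::{finite,linorder} expo \<Rightarrow> 'n cpoly \<Rightarrow> 'n cpoly" where
  "pdiffs \<beta> p = fold (\<lambda>k. pdiff k ^^ lookup \<beta> k) (sorted_list_of_set UNIV) p"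

text \<open>The action of \<open>\<Lambda> \<in> \<complex>[\<^bold>d]\<close> on \<open>\<complex>[\<^bold>x]\<close> as a differential operator followed by evaluation at 0.\<close>

definition act :: "'n::{finite,linorder} cpoly \<Rightarrow> 'n cpoly \<Rightarrow> complex" where
  "act \<Lambda> p = (\<Sum>\<beta>\<in>keys \<Lambda>. lookup \<Lambda> \<beta> * peval (\<lambda>_. 0) (pdiffs \<beta> p))"

definition perp :: "'n::{finite,linorder} cpoly set \<Rightarrow> 'n cpoly set" where
  "perp D = {p. \<forall>\<Lambda>\<in>D. act \<Lambda> p = 0}"

text \<open>Ideals are the submodules of the ring, viewed as a module over itself by multiplication.\<close>

definition ideal_gen :: "'n cpoly set \<Rightarrow> 'n cpoly set" where
  "ideal_gen S = module.span (*) S"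

definition ideal_power :: "'n cpoly set \<Rightarrow> nat \<Rightarrow> 'n cpoly set" where
  "ideal_power I s = ideal_gen {(\<Prod>i<s. f i) | f. \<forall>i<s. f i \<in> I}"

definition max_ideal :: "'n cpoly set" where
  "max_ideal = ideal_gen (var ` UNIV)"

definition subspace_sum :: "'n cpoly set \<Rightarrow> 'n cpoly set \<Rightarrow> 'n cpoly set" where
  "subspace_sum V W = {v + w | v w. v \<in> V \<and> w \<in> W}"

text \<open>
  \<open>UNIV // quot_rel W\<close> is the quotient space of \<open>\<complex>[\<^bold>x]\<close> by a subspace \<open>W\<close>; a linear combination of
  classes is the class of the corresponding linear combination of representatives. The
  definition of \<open>quotient_basis\<close> says that the classes of the elements of the finite set \<open>S\<close>,
  as a family indexed by \<open>S\<close>, are linearly independent and span; in particular they are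
  pairwise distinct.
\<close>

definition quot_rel :: "'n cpoly set \<Rightarrow> ('n cpoly \<times> 'n cpoly) set" where
  "quot_rel W = {(p, q). p - q \<in> W}"

definition quotient_basis :: "'n cpoly set \<Rightarrow> 'n cpoly set \<Rightarrow> bool" where
  "quotient_basis W S \<longleftrightarrow> finite S \<and>
    (\<forall>c. quot_rel W `` {\<Sum>b\<in>S. cscale (c b) b} = quot_rel W `` {0} \<longrightarrow> (\<forall>b\<in>S. c b = 0)) \<and>
    (\<forall>X \<in> UNIV // quot_rel W. \<exists>c. X = quot_rel W `` {\<Sum>b\<in>S. cscale (c b) b})"

definition division_closed :: "'n expo set \<Rightarrow> bool" where
  "division_closed E \<longleftrightarrow> (\<forall>\<beta>\<in>E. \<forall>k. lookup \<beta> k > 0 \<longrightarrow> \<beta> - ev k \<in> E)"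

definition mons_upto :: "'n::finite expo set \<Rightarrow> nat \<Rightarrow> 'n cpoly set" where
  "mons_upto E t = {mon \<alpha> | \<alpha>. \<alpha> \<in> E \<and> mdeg \<alpha> \<le> t}"

definition Hilb :: "nat \<Rightarrow> 'n::finite cpoly set set" where
  "Hilb r = {D. cpoly.subspace D \<and> cpoly.dim D = r \<and> D \<subseteq> cpoly_upto (r - 1) \<and>
    (\<forall>k. pdiff k ` D \<subseteq> D)}"

text \<open>\<open>trunc k \<Lambda>\<close> is \<open>\<Lambda>(d\<^sub>1, \<dots>, d\<^sub>k, 0, \<dots>, 0)\<close>: only terms without \<open>d\<^sub>l\<close>, \<open>l > k\<close>, survive.\<close>

definition trunc :: "'n::linorder \<Rightarrow> 'n cpoly \<Rightarrow> 'n cpoly" where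
  "trunc k \<Lambda> =
    (\<Sum>\<alpha> | \<alpha> \<in> keys \<Lambda> \<and> (\<forall>l>k. lookup \<alpha> l = 0). Poly_Mapping.single \<alpha> (lookup \<Lambda> \<alpha>))"

definition integ :: "'n::linorder \<Rightarrow> 'n cpoly \<Rightarrow> 'n cpoly" where
  "integ k \<Lambda> = (THE P. var k dvd P \<and> pdiff k P = trunc k \<Lambda>)"

lemma lookup_var_mult:
  "lookup (var k * p) \<alpha> = (if lookup \<alpha> k = 0 then 0 else lookup p (\<alpha> - ev k))"
proof -
  have *: "(\<Sum>q | \<alpha> = ev k + q. lookup p q) = (if lookup \<alpha> k = 0 then 0 else lookup p (\<alpha> - ev k))"
  proof (cases "lookup \<alpha> k = 0")
    case True
    then have "{q. \<alpha> = ev k + q} = {}"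
      by (auto simp: ev_def lookup_add)
    then show ?thesis using True by simp
  next
    case False
    then have "\<alpha> = ev k + (\<alpha> - ev k)"
      by (intro poly_mapping_eqI) (auto simp: ev_def lookup_add lookup_minus lookup_single when_def)
    moreover have "q = \<alpha> - ev k" if "\<alpha> = ev k + q" for q
      using that by simp
    ultimately have "{q. \<alpha> = ev k + q} = {\<alpha> - ev k}"
      by blast
    then show ?thesis using False by simp
  qed
  have **: "{q. \<alpha> = ev k + q} \<subseteq> {\<alpha> - ev k}"
    by auto
  have "lookup (var k * p) \<alpha> = (\<Sum>q. lookup p q when \<alpha> = ev k + q)"
    by (simp add: lookup_mult var_def mon_def lookup_single when_mult)
  also have "\<dots> = (\<Sum>q | \<alpha> = ev k + q. lookup p q)"
    using finite_subset[OF **]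
    by (subst Sum_any.expand_superset[where A = "{q. \<alpha> = ev k + q}"]) auto
  finally show ?thesis using * by simp
qed

lemma lookup_pdiff:
  "lookup (pdiff k p) \<alpha> = of_nat (lookup \<alpha> k + 1) * lookup p (\<alpha> + ev k)"
proof -
  have eq: "(of_nat (lookup \<gamma> k) * lookup p \<gamma> when \<gamma> - ev k = \<alpha>) =
      (of_nat (lookup \<alpha> k + 1) * lookup p (\<alpha> + ev k) when \<gamma> = \<alpha> + ev k)" for \<gamma>
  proof (cases "lookup \<gamma> k = 0")
    case True
    then have "\<gamma> \<noteq> \<alpha> + ev k"
      by (auto simp: ev_def lookup_add)
    then show ?thesis using True by simp
  next
    case False
    then have "\<gamma> = \<gamma> - ev k + ev k"
      by (intro poly_mapping_eqI) (auto simp: ev_def lookup_add lookup_minus lookup_single when_def)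
    then have "\<gamma> - ev k = \<alpha> \<longleftrightarrow> \<gamma> = \<alpha> + ev k"
      by (metis add_diff_cancel_right')
    then show ?thesis
      by (auto simp: when_def ev_def lookup_add)
  qed
  have "lookup (pdiff k p) \<alpha> =
      (\<Sum>\<gamma>\<in>keys p. (of_nat (lookup \<gamma> k) * lookup p \<gamma> when \<gamma> - ev k = \<alpha>))"
    by (simp add: pdiff_def lookup_sum lookup_single)
  also have "\<dots> = (\<Sum>\<gamma>\<in>keys p.
      (of_nat (lookup \<alpha> k + 1) * lookup p (\<alpha> + ev k) when \<gamma> = \<alpha> + ev k))"
    by (simp only: eq)
  also have "\<dots> = of_nat (lookup \<alpha> k + 1) * lookup p (\<alpha> + ev k)"
    by (cases "\<alpha> + ev k \<in> keys p")
       (auto simp: when_def in_keys_iff sum.delta intro!: sum.neutral)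
  finally show ?thesis .
qed

text \<open>The definite description in \<open>integ_def\<close> is well defined.\<close>

lemma integ_ex1: "\<exists>!P. var k dvd P \<and> pdiff k P = trunc k \<Lambda>"
proof -
  define T where "T = trunc k \<Lambda>"
  define Q where "Q = (\<Sum>\<alpha>\<in>keys T. Poly_Mapping.single \<alpha> (lookup T \<alpha> / of_nat (lookup \<alpha> k + 1)))"
  have Q: "lookup Q \<alpha> = lookup T \<alpha> / of_nat (lookup \<alpha> k + 1)" for \<alpha>
    by (cases "\<alpha> \<in> keys T")
       (auto simp: Q_def lookup_sum lookup_single when_def in_keys_iff sum.delta intro!: sum.neutral)
  have "pdiff k (var k * Q) = T"
  proof (rule poly_mapping_eqI)
    fix \<alpha>
    have "of_nat (Suc (lookup \<alpha> k)) \<noteq> (0::complex)"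
      by (simp only: of_nat_eq_0_iff)
    then show "lookup (pdiff k (var k * Q)) \<alpha> = lookup T \<alpha>"
      by (simp add: lookup_pdiff lookup_var_mult Q lookup_add ev_def del: of_nat_Suc)
  qed
  moreover have "P = P'"
    if "var k dvd P" "pdiff k P = T" "var k dvd P'" "pdiff k P' = T" for P P' :: "'a cpoly"
  proof (rule poly_mapping_eqI)
    fix \<alpha>
    show "lookup P \<alpha> = lookup P' \<alpha>"
    proof (cases "lookup \<alpha> k = 0")
      case True
      then show ?thesis using that(1,3) by (auto simp: dvd_def lookup_var_mult)
    next
      case False
      then have "\<alpha> = \<alpha> - ev k + ev k"
        by (intro poly_mapping_eqI) (auto simp: ev_def lookup_add lookup_minus lookup_single when_def)
      moreover have "of_nat (lookup (\<alpha> - ev k) k + 1) \<noteq> (0::complex)"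
        by (simp only: of_nat_eq_0_iff)
      moreover have "lookup (pdiff k P) (\<alpha> - ev k) = lookup (pdiff k P') (\<alpha> - ev k)"
        using that by simp
      ultimately show ?thesis
        by (metis lookup_pdiff mult_left_cancel)
    qed
  qed
  ultimately show ?thesis
    unfolding T_def[symmetric] by (intro ex1I[of _ "var k * Q"]) auto
qed

end

theory Submission
  imports Defs
begin

text \<open>
  The pairing between \<open>\<complex>[\<^bold>d]\<close> and \<open>\<complex>[\<^bold>x]\<close> is diagonal in coefficients (\<open>act_eq_sum\<close>). Hence
  \<open>\<^bold>d\<^sup>\<alpha>/\<alpha>!\<close> is the functional dual to \<open>\<^bold>x\<^sup>\<alpha>\<close>, the coefficient \<open>\<mu>\<close> of a functional at \<open>\<alpha>\<close> is its value
  at \<open>\<^bold>x\<^sup>\<alpha>\<close>, differentiating a functional is the transpose of multiplication by a variable,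
  and \<open>\<mm>\<^sup>t\<^sup>+\<^sup>1\<close> is orthogonal to the functionals of degree at most \<open>t\<close>. Since \<open>D\<close> is finite-dimensional,
  it is also its own biorthogonal (\<open>mem_if_perp_subset\<close>). Together these facts translate the
  conditions on the quotients: the monomials of degree at most \<open>t\<close> in \<open>B\<close> form a basis of the quotient
  for every \<open>t\<close> if and only if \<open>D\<close> has a basis dual to \<open>B\<close> in which the member
  belonging to a monomial \<open>\<beta>\<^sub>i\<close> has degree at most \<open>|\<beta>\<^sub>i|\<close> (\<open>coordinate_functional\<close> and
  \<open>quotient_basis_of_graded_dual_basis\<close>).

  It remains to translate stability under differentiation for such a basis. If \<open>D\<close> is stable, then
  \<open>\<partial>\<^sub>k \<Lambda>\<^sub>i\<close> is a combination of the \<open>\<Lambda>\<^sub>j\<close> of lower degree, and the coefficient at \<open>\<Lambda>\<^sub>j\<close> is the value of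
  \<open>\<Lambda>\<^sub>i\<close> at \<open>x\<^sub>k \<^bold>x\<^sup>\<beta>\<^sup>j\<close> by duality (\<open>pdiff_dual_expansion\<close>). A functional without constant
  term is the sum of the integrals of its partial derivatives, where \<open>I\<^sub>k\<close> contributes the terms with
  last variable \<open>d\<^sub>k\<close> (\<open>sum_integ_pdiff\<close>); this is the first system of equations. The quadratic
  system says that \<open>\<partial>\<^sub>k\<close> and \<open>\<partial>\<^sub>l\<close> commute on \<open>\<Lambda>\<^sub>i\<close> (\<open>act_commutation\<close>), and the last system is
  duality again. Conversely, the quadratic system makes the candidates for the partial derivatives of
  \<open>\<Lambda>\<^sub>i\<close> a closed family, and by the Poincare lemma (\<open>pdiff_sum_integ\<close>) the polynomial that the
  first system builds from them has exactly these derivatives. An induction on the degree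
  (\<open>pdiff_of_integration_equations\<close>) then gives stability as well as the degree bounds.
\<close>

section \<open>Exponents and coefficients\<close>

lemma lookup_cscale [simp]: "lookup (cscale c p) \<alpha> = c * lookup p \<alpha>"
proof -
  have "{k. (c when k = 0) \<noteq> 0} \<subseteq> {0}"
    by (auto simp: when_def)
  then show ?thesis
    unfolding cscale_def lookup_mult
    by (subst Sum_any.expand_superset[of "{0}"]) (auto simp: lookup_single when_def)
qed

lemma lookup_mon: "lookup (mon \<alpha>) \<gamma> = (1 when \<alpha> = \<gamma>)"
  by (simp add: mon_def lookup_single)

lemma lookup_ev: "lookup (ev k) l = (1 when k = l)"
  by (simp add: ev_def lookup_single)

lemma inj_mon: "inj mon"
  by (metis injI keys_single mon_def singleton_inject zero_neq_one)

lemma mdeg_0 [simp]: "mdeg 0 = 0"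
  by (simp add: mdeg_def)

lemma mdeg_ev [simp]: "mdeg (ev k) = 1"
  by (simp add: mdeg_def lookup_ev when_def sum.delta)

lemma mdeg_add [simp]: "mdeg (\<alpha> + \<gamma>) = mdeg \<alpha> + mdeg \<gamma>"
  by (simp add: mdeg_def lookup_add sum.distrib)

lemma mdeg_eq_0_iff [simp]: "mdeg \<alpha> = 0 \<longleftrightarrow> \<alpha> = 0"
  by (auto simp: mdeg_def intro: poly_mapping_eqI)

lemma mfact_nonzero [simp]: "mfact \<alpha> \<noteq> 0"
  by (simp add: mfact_def)

lemma mfact_add_ev: "mfact (\<alpha> + ev k) = of_nat (lookup \<alpha> k + 1) * mfact \<alpha>"
proof -
  have "mfact (\<alpha> + ev k) = (\<Prod>l\<in>UNIV. (if l = k then of_nat (lookup \<alpha> k + 1) else 1) * fact (lookup \<alpha> l))"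
    unfolding mfact_def by (intro prod.cong) (auto simp: lookup_add lookup_ev)
  then show ?thesis
    by (simp add: prod.distrib prod.delta mfact_def)
qed

lemma expo_minus_ev: "lookup \<alpha> k \<noteq> 0 \<Longrightarrow> \<alpha> = (\<alpha> - ev k) + ev k"
  by (rule poly_mapping_eqI) (auto simp: lookup_add lookup_minus lookup_ev when_def)

lemma expo_nonzero_obtains:
  assumes "\<alpha> \<noteq> (0 :: 'n expo)"
  obtains k \<gamma> where "\<alpha> = \<gamma> + ev k"
proof -
  obtain k where "lookup \<alpha> k \<noteq> 0"
    using assms by (metis poly_mapping_eqI lookup_zero)
  then show thesis
    using that[OF expo_minus_ev] by simp
qed

lemma finite_mdeg_less: "finite {\<alpha> :: 'n::finite expo. mdeg \<alpha> < t}"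
proof (induction t)
  case (Suc t)
  have "{\<alpha> :: 'n expo. mdeg \<alpha> < Suc t} \<subseteq> insert 0 (\<Union>k. (\<lambda>\<alpha>. \<alpha> + ev k) ` {\<alpha>. mdeg \<alpha> < t})"
  proof
    fix \<alpha> :: "'n expo"
    assume *: "\<alpha> \<in> {\<alpha>. mdeg \<alpha> < Suc t}"
    show "\<alpha> \<in> insert 0 (\<Union>k. (\<lambda>\<alpha>. \<alpha> + ev k) ` {\<alpha>. mdeg \<alpha> < t})"
    proof (cases "\<alpha> = 0")
      case False
      then obtain k \<gamma> where "\<alpha> = \<gamma> + ev k"
        by (rule expo_nonzero_obtains)
      moreover from this have "mdeg \<gamma> < t"
        using * by simp
      ultimately show ?thesis
        by blast
    qed simp
  qed
  then show ?case
    by (rule finite_subset) (use Suc in auto)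
qed simp

lemma pdiff_add: "pdiff k (p + q) = pdiff k p + pdiff k q"
  by (rule poly_mapping_eqI) (simp add: lookup_pdiff lookup_add algebra_simps)

lemma pdiff_cscale: "pdiff k (cscale c p) = cscale c (pdiff k p)"
  by (rule poly_mapping_eqI) (simp add: lookup_pdiff)

lemma pdiff_sum: "pdiff k (sum f A) = (\<Sum>a\<in>A. pdiff k (f a))"
  by (rule poly_mapping_eqI) (simp add: lookup_pdiff lookup_sum sum_distrib_left)

lemma pdiff_zero: "pdiff k 0 = 0"
  by (simp add: pdiff_def)

lemma pdiff_one: "pdiff k 1 = 0"
proof (rule poly_mapping_eqI)
  fix \<alpha>
  have "\<alpha> + ev k \<noteq> 0"
    by (metis add_eq_0_iff_both_eq_0 ev_def lookup_add lookup_single_eq lookup_zero zero_neq_one)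
  then show "lookup (pdiff k 1) \<alpha> = lookup 0 \<alpha>"
    by (simp add: lookup_pdiff lookup_one)
qed

lemma pdiff_commute: "pdiff k (pdiff l p) = pdiff l (pdiff k p)"
  by (rule poly_mapping_eqI)
     (auto simp: lookup_pdiff lookup_add lookup_ev when_def ac_simps)

section \<open>Functionals in coordinates\<close>

lemma lookup_pdiff_pow:
  assumes "lookup \<alpha> k = 0"
  shows "lookup ((pdiff k ^^ m) p) \<alpha> = fact m * lookup p (\<alpha> + Poly_Mapping.single k m)"
proof (induction m arbitrary: p)
  case (Suc m)
  have *: "Poly_Mapping.single k m + ev k = Poly_Mapping.single k (Suc m)"
    by (simp add: ev_def flip: single_add)
  show ?case
    using assms
    by (simp del: funpow.simps add: funpow_Suc_right Suc.IH lookup_pdiff lookup_add add.assoc *)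
qed simp

lemma lookup_fold_pdiff_pow:
  assumes "distinct xs"
  shows "lookup (fold (\<lambda>k. pdiff k ^^ lookup \<gamma> k) xs p) 0 =
    (\<Prod>k\<in>set xs. fact (lookup \<gamma> k)) * lookup p (\<Sum>k\<in>set xs. Poly_Mapping.single k (lookup \<gamma> k))"
  using assms
proof (induction xs arbitrary: p)
  case (Cons k xs)
  have "lookup (\<Sum>l\<in>set xs. Poly_Mapping.single l (lookup \<gamma> l)) k = 0"
    using Cons.prems by (auto simp: lookup_sum lookup_single when_def)
  then show ?case
    using Cons by (simp add: lookup_pdiff_pow add.commute)
qed simp

lemma peval_zero: "peval (\<lambda>_. 0) p = lookup p 0"
proof -
  have "(\<Prod>k\<in>UNIV. (0::complex) ^ lookup \<alpha> k) = (1 when \<alpha> = 0)" for \<alpha> :: "'a expo"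
  proof (cases "\<alpha> = 0")
    case False
    then obtain k where "lookup \<alpha> k \<noteq> 0"
      by (metis poly_mapping_eqI lookup_zero)
    then show ?thesis
      using False by (auto intro!: prod_zero exI[of _ k])
  qed simp
  then have "peval (\<lambda>_. 0) p = (\<Sum>\<alpha>\<in>keys p. if \<alpha> = 0 then lookup p 0 else 0)"
    unfolding peval_def by (intro sum.cong) auto
  then show ?thesis
    by (simp add: in_keys_iff)
qed

lemma peval_pdiffs: "peval (\<lambda>_. 0) (pdiffs \<gamma> p) = mfact \<gamma> * lookup p \<gamma>"
proof -
  have "(\<Sum>k\<in>UNIV. Poly_Mapping.single k (lookup \<gamma> k)) = \<gamma>"
    by (rule poly_mapping_eqI) (simp add: lookup_sum lookup_single when_def sum.delta)
  then show ?thesis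
    by (simp add: peval_zero pdiffs_def lookup_fold_pdiff_pow mfact_def)
qed

text \<open>
  The functionals \<open>\<^bold>d\<^sup>\<alpha>/\<alpha>!\<close> are dual to the monomials, so the pairing is diagonal in
  coefficients. The free choice of the index set makes bilinearity immediate.
\<close>

lemma act_eq_sum:
  assumes "finite A" "keys \<Lambda> \<subseteq> A \<or> keys p \<subseteq> A"
  shows "act \<Lambda> p = (\<Sum>\<alpha>\<in>A. lookup \<Lambda> \<alpha> * (mfact \<alpha> * lookup p \<alpha>))"
  unfolding act_def peval_pdiffs
  using assms
  by (intro sum.mono_neutral_cong) (auto simp: in_keys_iff)

lemma act_mon: "act \<Lambda> (mon \<alpha>) = mfact \<alpha> * lookup \<Lambda> \<alpha>"
  by (subst act_eq_sum[of "{\<alpha>}"]) (auto simp: mon_def)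

lemma act_one_mon: "act 1 (mon \<alpha>) = (1 when \<alpha> = 0)"
  by (simp add: act_mon lookup_one mfact_def when_def)

lemma act_add_left: "act (u + v) p = act u p + act v p"
  by (simp add: act_eq_sum[of "keys p"] lookup_add algebra_simps sum.distrib)

lemma act_cscale_left: "act (cscale c u) p = c * act u p"
  by (simp add: act_eq_sum[of "keys p"] sum_distrib_left algebra_simps)

lemma act_sum_left: "act (sum f I) p = (\<Sum>i\<in>I. act (f i) p)"
  by (simp add: act_eq_sum[of "keys p"] lookup_sum sum_distrib_right sum.swap[of _ I])

lemma act_add_right: "act u (p + q) = act u p + act u q"
  by (simp add: act_eq_sum[of "keys u"] lookup_add algebra_simps sum.distrib)

lemma act_cscale_right: "act u (cscale c p) = c * act u p"
  by (simp add: act_eq_sum[of "keys u"] sum_distrib_left algebra_simps)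

lemma act_sum_right: "act u (sum f I) = (\<Sum>i\<in>I. act u (f i))"
  by (simp add: act_eq_sum[of "keys u"] lookup_sum sum_distrib_left sum.swap[of _ I])

lemma act_diff_right: "act u (p - q) = act u p - act u q"
  by (simp add: act_eq_sum[of "keys u"] lookup_minus algebra_simps sum_subtractf)

lemma act_diff_left: "act (u - v) p = act u p - act v p"
  by (simp add: act_eq_sum[of "keys p"] lookup_minus algebra_simps sum_subtractf)

lemma act_zero_left: "act 0 p = 0"
  by (simp add: act_def)

lemma act_zero_right: "act u 0 = 0"
  using act_cscale_right[of u 0 0] by simp

text \<open>Differentiating a functional is the transpose of multiplication by the variable.\<close>

lemma act_pdiff_mon: "act (pdiff k \<Lambda>) (mon \<alpha>) = act \<Lambda> (mon (\<alpha> + ev k))"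
  by (simp add: act_mon lookup_pdiff mfact_add_ev)

lemma act_mon_eq_0: "v \<in> cpoly_upto t \<Longrightarrow> t < mdeg \<alpha> \<Longrightarrow> act v (mon \<alpha>) = 0"
  by (force simp: act_mon cpoly_upto_def in_keys_iff)

lemma subspace_perp: "cpoly.subspace (perp D)"
  by (auto simp: cpoly.subspace_def perp_def act_zero_right act_add_right act_cscale_right)

lemma act_span_eq_0:
  assumes "v \<in> cpoly.span S" "\<And>s. s \<in> S \<Longrightarrow> act s p = 0"
  shows "act v p = 0"
proof -
  have "cpoly.span S \<subseteq> {v. act v p = 0}"
    by (rule cpoly.span_minimal)
       (use assms(2) in \<open>auto simp: cpoly.subspace_def act_add_left act_cscale_left act_zero_left\<close>)
  then show ?thesis
    using assms(1) by blast
qed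

text \<open>
  The reason why a finite-dimensional space of functionals is its own biorthogonal. In the step
  from \<open>S\<close> to \<open>insert s S\<close>, a \<open>q\<close> that separates \<open>s\<close> from \<open>S\<close> corrects a polynomial
  killed by \<open>S\<close> to one killed by \<open>s\<close> as well; on such corrected polynomials \<open>\<Lambda>\<close> acts like
  \<open>\<Lambda> - c s\<close>, which is still outside the span of \<open>S\<close>.
\<close>

lemma separating_polynomial:
  assumes "finite S" "\<Lambda> \<notin> cpoly.span S"
  shows "\<exists>p. (\<forall>s\<in>S. act s p = 0) \<and> act \<Lambda> p \<noteq> 0"
  using assms
proof (induction S arbitrary: \<Lambda> rule: finite_induct)
  case empty
  then obtain \<alpha> where "lookup \<Lambda> \<alpha> \<noteq> 0"
    by (metis cpoly.span_empty poly_mapping_eqI lookup_zero singletonI)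
  then show ?case
    by (intro exI[of _ "mon \<alpha>"]) (simp add: act_mon)
next
  case (insert s S)
  show ?case
  proof (cases "s \<in> cpoly.span S")
    case True
    have "\<Lambda> \<notin> cpoly.span S"
      using insert.prems cpoly.span_mono[of S "insert s S"] by blast
    then obtain p where p: "\<forall>s\<in>S. act s p = 0" "act \<Lambda> p \<noteq> 0"
      using insert.IH by blast
    have "act s p = 0"
      using act_span_eq_0[OF True] p(1) by blast
    then show ?thesis
      using p by blast
  next
    case False
    then obtain q where q: "\<forall>s\<in>S. act s q = 0" "act s q \<noteq> 0"
      using insert.IH by blast
    define c where "c = act \<Lambda> q / act s q"
    have "\<Lambda> - cscale c s \<notin> cpoly.span S"
      using insert.prems cpoly.span_breakdown_eq by blast
    then obtain p where p: "\<forall>s\<in>S. act s p = 0" "act (\<Lambda> - cscale c s) p \<noteq> 0"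
      using insert.IH by blast
    show ?thesis
      using p q
      by (intro exI[of _ "p - cscale (act s p / act s q) q"])
         (auto simp: act_diff_right act_diff_left act_cscale_right act_cscale_left c_def field_simps)
  qed
qed

lemma mem_if_perp_subset:
  assumes "finite T" "\<And>p. p \<in> perp (cpoly.span T) \<Longrightarrow> act v p = 0"
  shows "v \<in> cpoly.span T"
proof (rule ccontr)
  assume "v \<notin> cpoly.span T"
  then obtain p where p: "\<forall>s\<in>T. act s p = 0" "act v p \<noteq> 0"
    using separating_polynomial assms(1) by blast
  then have "p \<in> perp (cpoly.span T)"
    by (auto simp: perp_def intro: act_span_eq_0)
  then show False
    using assms(2) p(2) by blast
qed

section \<open>Powers of the maximal ideal\<close>

definition cpoly_from :: "nat \<Rightarrow> 'n::finite cpoly set" where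
  "cpoly_from t = {p. \<forall>\<alpha>\<in>keys p. t \<le> mdeg \<alpha>}"

lemma module_mult: "module ((*) :: 'n cpoly \<Rightarrow> 'n cpoly \<Rightarrow> 'n cpoly)"
  by unfold_locales (simp_all add: algebra_simps)

lemma cpoly_from_mult: "p \<in> cpoly_from s \<Longrightarrow> q \<in> cpoly_from t \<Longrightarrow> p * q \<in> cpoly_from (s + t)"
  using keys_mult[of p q] by (force simp: cpoly_from_def intro: add_mono)

lemma cpoly_from_add: "p \<in> cpoly_from s \<Longrightarrow> q \<in> cpoly_from s \<Longrightarrow> p + q \<in> cpoly_from s"
  using keys_add[of p q] by (auto simp: cpoly_from_def)

lemma ideal_gen_subset_cpoly_from:
  assumes "S \<subseteq> cpoly_from s"
  shows "ideal_gen S \<subseteq> cpoly_from s"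
  unfolding ideal_gen_def
proof (rule module.span_minimal[OF module_mult assms])
  have "p * q \<in> cpoly_from s" if "q \<in> cpoly_from s" for p q :: "'a cpoly"
    using cpoly_from_mult[of p 0 q s] that by (simp add: cpoly_from_def)
  then show "module.subspace (*) (cpoly_from s :: 'a cpoly set)"
    by (auto simp: module.subspace_def[OF module_mult] cpoly_from_add) (simp add: cpoly_from_def)
qed

lemma max_ideal_subset: "max_ideal \<subseteq> cpoly_from 1"
  unfolding max_ideal_def
  by (rule ideal_gen_subset_cpoly_from) (auto simp: cpoly_from_def var_def mon_def)

lemma mon_factors:
  "s \<le> mdeg \<alpha> \<Longrightarrow> \<exists>f q. (\<forall>i<s. f i \<in> max_ideal) \<and> mon \<alpha> = q * (\<Prod>i<s. f i)"
proof (induction s arbitrary: \<alpha>)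
  case (Suc s)
  then have "\<alpha> \<noteq> 0"
    by auto
  then obtain k \<gamma> where \<alpha>: "\<alpha> = \<gamma> + ev k"
    by (rule expo_nonzero_obtains)
  then obtain f q where f: "\<forall>i<s. f i \<in> max_ideal" "mon \<gamma> = q * (\<Prod>i<s. f i)"
    using Suc by force
  have "mon \<alpha> = mon \<gamma> * var k"
    by (simp add: \<alpha> mon_def var_def mult_single)
  also have "\<dots> = q * (\<Prod>i<Suc s. (f(s := var k)) i)"
    by (simp add: f(2) mult.assoc)
  finally have "mon \<alpha> = q * (\<Prod>i<Suc s. (f(s := var k)) i)" .
  moreover have "var k \<in> max_ideal"
    unfolding max_ideal_def ideal_gen_def by (rule module.span_base[OF module_mult]) simp
  then have "\<forall>i<Suc s. (f(s := var k)) i \<in> max_ideal"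
    using f(1) by auto
  ultimately show ?case
    by (intro exI[of _ "f(s := var k)"] exI[of _ q] conjI)
qed (auto intro: exI[of _ "mon \<alpha>"])

lemma cpoly_expansion: "p = (\<Sum>\<alpha>\<in>keys p. cscale (lookup p \<alpha>) (mon \<alpha>))"
  by (rule poly_mapping_eqI)
     (auto simp: lookup_sum lookup_mon mult_when when_def in_keys_iff if_distrib cong: if_cong)

lemma ideal_power_max_ideal: "ideal_power max_ideal s = (cpoly_from s :: 'n::finite cpoly set)"
proof
  have "(\<Prod>i<s. f i) \<in> cpoly_from s" if "\<forall>i<s. f i \<in> max_ideal" for f :: "nat \<Rightarrow> 'n cpoly"
    using that
  proof (induction s)
    case (Suc s)
    then show ?case
      using cpoly_from_mult[of "\<Prod>i<s. f i" s "f s" 1] max_ideal_subset by auto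
  qed (simp add: cpoly_from_def)
  then show "ideal_power max_ideal s \<subseteq> (cpoly_from s :: 'n cpoly set)"
    unfolding ideal_power_def by (intro ideal_gen_subset_cpoly_from) auto
next
  show "(cpoly_from s :: 'n cpoly set) \<subseteq> ideal_power max_ideal s"
  proof
    fix p :: "'n cpoly"
    assume p: "p \<in> cpoly_from s"
    have "cscale (lookup p \<alpha>) (mon \<alpha>) \<in> ideal_power max_ideal s" if \<alpha>: "\<alpha> \<in> keys p" for \<alpha>
    proof -
      obtain f q where f: "\<forall>i<s. f i \<in> max_ideal" "mon \<alpha> = q * (\<Prod>i<s. f i)"
        using mon_factors p \<alpha> unfolding cpoly_from_def by blast
      then have "cscale (lookup p \<alpha>) (mon \<alpha>) =
          (Poly_Mapping.single 0 (lookup p \<alpha>) * q) * (\<Prod>i<s. f i)"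
        by (simp add: cscale_def mult.assoc)
      moreover have "(\<Prod>i<s. f i) \<in> ideal_power max_ideal s"
        unfolding ideal_power_def ideal_gen_def
        by (rule module.span_base[OF module_mult]) (use f in blast)
      ultimately show ?thesis
        by (simp add: ideal_power_def ideal_gen_def module.span_scale[OF module_mult])
    qed
    then have "(\<Sum>\<alpha>\<in>keys p. cscale (lookup p \<alpha>) (mon \<alpha>)) \<in> ideal_power max_ideal s"
      unfolding ideal_power_def ideal_gen_def by (intro module.span_sum[OF module_mult])
    then show "p \<in> ideal_power max_ideal s"
      by (simp flip: cpoly_expansion)
  qed
qed

lemma subspace_cpoly_from: "cpoly.subspace (cpoly_from s)"
  by (auto simp: cpoly.subspace_def cpoly_from_add) (auto simp: cpoly_from_def in_keys_iff)

lemma act_eq_0_if_upto_from: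
  assumes "v \<in> cpoly_upto t" "w \<in> cpoly_from (t + 1)"
  shows "act v w = 0"
proof -
  have "lookup v \<alpha> * (mfact \<alpha> * lookup w \<alpha>) = 0" for \<alpha>
  proof (cases "mdeg \<alpha> \<le> t")
    case True
    then have "lookup w \<alpha> = 0"
      using assms(2) by (force simp: cpoly_from_def in_keys_iff)
    then show ?thesis
      by simp
  next
    case False
    then have "lookup v \<alpha> = 0"
      using assms(1) by (force simp: cpoly_upto_def in_keys_iff)
    then show ?thesis
      by simp
  qed
  then show ?thesis
    using act_eq_sum[of "keys v" v w] by (simp del: mult_eq_0_iff)
qed

section \<open>Monomial bases of quotients\<close>

lemma subspace_subspace_sum:
  "cpoly.subspace V \<Longrightarrow> cpoly.subspace W \<Longrightarrow> cpoly.subspace (subspace_sum V W)"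
  unfolding subspace_sum_def by (rule cpoly.subspace_sums)

lemma mem_subspace_sum_left: "cpoly.subspace W \<Longrightarrow> v \<in> V \<Longrightarrow> v \<in> subspace_sum V W"
  unfolding subspace_sum_def by (force dest: cpoly.subspace_0)

lemma mem_subspace_sum_right: "cpoly.subspace V \<Longrightarrow> w \<in> W \<Longrightarrow> w \<in> subspace_sum V W"
  unfolding subspace_sum_def by (force dest: cpoly.subspace_0)

lemma quot_rel_eq_iff:
  assumes "cpoly.subspace W"
  shows "quot_rel W `` {p} = quot_rel W `` {q} \<longleftrightarrow> p - q \<in> W"
proof
  assume *: "quot_rel W `` {p} = quot_rel W `` {q}"
  have "q \<in> quot_rel W `` {q}"
    using cpoly.subspace_0[OF assms] by (simp add: quot_rel_def)
  then have "q \<in> quot_rel W `` {p}"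
    using * by simp
  then show "p - q \<in> W"
    by (simp add: quot_rel_def)
next
  assume *: "p - q \<in> W"
  have "p - u \<in> W \<longleftrightarrow> q - u \<in> W" for u
    using cpoly.subspace_add[OF assms *, of "q - u"] cpoly.subspace_diff[OF assms _ *, of "p - u"]
    by auto
  then show "quot_rel W `` {p} = quot_rel W `` {q}"
    by (auto simp: quot_rel_def)
qed

lemma quotient_basis_mon_iff:
  assumes W: "cpoly.subspace W" and "finite A"
  shows "quotient_basis W (mon ` A) \<longleftrightarrow>
    (\<forall>c. (\<Sum>\<alpha>\<in>A. cscale (c \<alpha>) (mon \<alpha>)) \<in> W \<longrightarrow> (\<forall>\<alpha>\<in>A. c \<alpha> = 0)) \<and>
    (\<forall>p. \<exists>c. p - (\<Sum>\<alpha>\<in>A. cscale (c \<alpha>) (mon \<alpha>)) \<in> W)"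
proof -
  have sum: "(\<Sum>b\<in>mon ` A. cscale (c b) b) = (\<Sum>\<alpha>\<in>A. cscale (c (mon \<alpha>)) (mon \<alpha>))" for c
    by (simp add: sum.reindex[OF inj_on_subset[OF inj_mon subset_UNIV]])
  have ex: "\<exists>c'. c = (\<lambda>\<alpha>. c' (mon \<alpha>))" for c :: "'a expo \<Rightarrow> complex"
    by (rule exI[of _ "c \<circ> inv mon"]) (simp add: inv_f_f[OF inj_mon])
  have all: "(\<forall>c. P (\<lambda>\<alpha>. c (mon \<alpha>))) \<longleftrightarrow> (\<forall>c. P c)" for P :: "('a expo \<Rightarrow> complex) \<Rightarrow> bool"
  proof safe
    fix c
    assume "\<forall>c. P (\<lambda>\<alpha>. c (mon \<alpha>))"
    then show "P c"
      using ex[of c] by auto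
  qed auto
  have "quotient_basis W (mon ` A) \<longleftrightarrow>
    (\<forall>c. (\<Sum>\<alpha>\<in>A. cscale (c (mon \<alpha>)) (mon \<alpha>)) \<in> W \<longrightarrow> (\<forall>\<alpha>\<in>A. c (mon \<alpha>) = 0)) \<and>
    (\<forall>p. \<not> (\<forall>c. p - (\<Sum>\<alpha>\<in>A. cscale (c (mon \<alpha>)) (mon \<alpha>)) \<notin> W))"
    unfolding quotient_basis_def sum quotient_def
    using assms by (simp add: quot_rel_eq_iff)
  then show ?thesis
    unfolding
      all[of "\<lambda>c. (\<Sum>\<alpha>\<in>A. cscale (c \<alpha>) (mon \<alpha>)) \<in> W \<longrightarrow> (\<forall>\<alpha>\<in>A. c \<alpha> = 0)"]
      all[of "\<lambda>c. _ - (\<Sum>\<alpha>\<in>A. cscale (c \<alpha>) (mon \<alpha>)) \<notin> W"]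
    by simp
qed

text \<open>
  The quotient by \<open>D\<^sup>\<bottom> + \<mm>\<^sup>t\<^sup>+\<^sup>1\<close> is dual to the functionals of \<open>D\<close> of degree at most \<open>t\<close>. So the
  coordinate function of a basis monomial \<open>\<gamma>\<close> is an element of \<open>D\<close>: it vanishes on \<open>\<mm>\<^sup>t\<^sup>+\<^sup>1\<close>,
  hence is a polynomial in \<open>\<^bold>d\<close> of degree at most \<open>t\<close>, and it vanishes on \<open>D\<^sup>\<bottom>\<close>, hence
  lies in \<open>D\<close>.
\<close>

lemma coordinate_functional:
  fixes T :: "'n::{finite,linorder} cpoly set"
  assumes T: "finite T" and A: "finite A" "\<gamma> \<in> A"
    and qb: "quotient_basis (subspace_sum (perp (cpoly.span T)) (cpoly_from (t + 1))) (mon ` A)"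
  shows "\<exists>v. v \<in> cpoly.span T \<and> v \<in> cpoly_upto t \<and>
    (\<forall>\<alpha>\<in>A. act v (mon \<alpha>) = (if \<alpha> = \<gamma> then 1 else 0))"
proof -
  define W where "W = subspace_sum (perp (cpoly.span T)) (cpoly_from (t + 1))"
  have W: "cpoly.subspace W"
    unfolding W_def by (intro subspace_subspace_sum subspace_perp subspace_cpoly_from)
  have indep: "c \<alpha> = 0" if "(\<Sum>\<alpha>\<in>A. cscale (c \<alpha>) (mon \<alpha>)) \<in> W" "\<alpha> \<in> A" for c \<alpha>
    using qb that unfolding W_def[symmetric] quotient_basis_mon_iff[OF W A(1)] by blast
  obtain c where c: "p - (\<Sum>\<alpha>\<in>A. cscale (c p \<alpha>) (mon \<alpha>)) \<in> W" for p
    using qb unfolding W_def[symmetric] quotient_basis_mon_iff[OF W A(1)] by metis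
  define L where "L = {\<delta> :: 'n expo. mdeg \<delta> < Suc t}"
  have "finite L"
    unfolding L_def by (rule finite_mdeg_less)
  \<comment> \<open>Another choice of coordinates modulo \<open>W\<close>, now linear in \<open>p\<close>: drop the terms of
    degree greater than \<open>t\<close>, which lie in \<open>W\<close>, and reduce each remaining monomial by \<open>c\<close>.\<close>
  define a where "a p \<alpha> = (\<Sum>\<delta>\<in>L. lookup p \<delta> * c (mon \<delta>) \<alpha>)" for p \<alpha>
  have a: "p - (\<Sum>\<alpha>\<in>A. cscale (a p \<alpha>) (mon \<alpha>)) \<in> W" for p
  proof -
    define q where "q = (\<Sum>\<delta>\<in>L. cscale (lookup p \<delta>) (mon \<delta>))"
    have q: "lookup q \<alpha> = (if \<alpha> \<in> L then lookup p \<alpha> else 0)" for \<alpha>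
      using \<open>finite L\<close>
      by (simp add: q_def lookup_sum lookup_mon when_def if_distrib cong: if_cong)
    then have "p - q \<in> cpoly_from (t + 1)"
      by (auto simp: cpoly_from_def in_keys_iff lookup_minus L_def split: if_splits)
    then have "p - q \<in> W"
      unfolding W_def by (intro mem_subspace_sum_right subspace_perp)
    moreover have "(\<Sum>\<delta>\<in>L. cscale (lookup p \<delta>)
        (mon \<delta> - (\<Sum>\<alpha>\<in>A. cscale (c (mon \<delta>) \<alpha>) (mon \<alpha>)))) \<in> W"
      by (intro cpoly.subspace_sum cpoly.subspace_scale W c)
    moreover have "(\<Sum>\<delta>\<in>L. cscale (lookup p \<delta>)
        (mon \<delta> - (\<Sum>\<alpha>\<in>A. cscale (c (mon \<delta>) \<alpha>) (mon \<alpha>)))) = q - (\<Sum>\<alpha>\<in>A. cscale (a p \<alpha>) (mon \<alpha>))"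
      by (simp add: cpoly.scale_right_diff_distrib sum_subtractf q_def a_def cpoly.scale_sum_left
          cpoly.scale_sum_right sum.swap[of _ L])
    ultimately have "(p - q) + (q - (\<Sum>\<alpha>\<in>A. cscale (a p \<alpha>) (mon \<alpha>))) \<in> W"
      using cpoly.subspace_add[OF W] by metis
    then show ?thesis
      by simp
  qed
  define v where "v = (\<Sum>\<delta>\<in>L. cscale (c (mon \<delta>) \<gamma> / mfact \<delta>) (mon \<delta>))"
  have v: "lookup v \<alpha> = (if \<alpha> \<in> L then c (mon \<alpha>) \<gamma> / mfact \<alpha> else 0)" for \<alpha>
    using \<open>finite L\<close>
    by (simp add: v_def lookup_sum lookup_mon when_def if_distrib cong: if_cong)
  have v_upto: "v \<in> cpoly_upto t"
    using v by (auto simp: cpoly_upto_def in_keys_iff L_def split: if_splits)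
  have act_v: "act v p = a p \<gamma>" for p
  proof -
    have "keys v \<subseteq> L"
      using v by (auto simp: in_keys_iff split: if_splits)
    then show ?thesis
      using \<open>finite L\<close> by (auto simp: act_eq_sum[of L] v a_def intro!: sum.cong)
  qed
  have "v \<in> cpoly.span T"
  proof (rule mem_if_perp_subset[OF T])
    fix p
    assume "p \<in> perp (cpoly.span T)"
    then have "p \<in> W"
      unfolding W_def by (intro mem_subspace_sum_left subspace_cpoly_from)
    then have "p - (p - (\<Sum>\<alpha>\<in>A. cscale (a p \<alpha>) (mon \<alpha>))) \<in> W"
      using cpoly.subspace_diff[OF W] a by blast
    then show "act v p = 0"
      using indep[of "a p"] A(2) by (simp add: act_v)
  qed
  moreover have "act v (mon \<alpha>) = (if \<alpha> = \<gamma> then 1 else 0)" if "\<alpha> \<in> A" for \<alpha>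
  proof -
    have "(\<Sum>\<alpha>'\<in>A. cscale ((if \<alpha>' = \<alpha> then 1 else 0) - a (mon \<alpha>) \<alpha>') (mon \<alpha>')) =
        mon \<alpha> - (\<Sum>\<alpha>'\<in>A. cscale (a (mon \<alpha>) \<alpha>') (mon \<alpha>'))"
      using that A(1)
      by (simp add: cpoly.scale_left_diff_distrib sum_subtractf if_distrib[of "\<lambda>x. cscale x _"]
          cong: if_cong)
    then have "(if \<gamma> = \<alpha> then 1 else 0) - a (mon \<alpha>) \<gamma> = 0"
      using indep[of "\<lambda>\<alpha>'. (if \<alpha>' = \<alpha> then 1 else 0) - a (mon \<alpha>) \<alpha>'"] a A(2) by metis
    then show ?thesis
      by (auto simp: act_v split: if_splits)
  qed
  ultimately show ?thesis
    using v_upto by blast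
qed

section \<open>Dual families\<close>

lemma dual_expansion:
  assumes I: "finite I"
    and dual: "\<And>i j. i \<in> I \<Longrightarrow> j \<in> I \<Longrightarrow> act (\<Lambda> i) (p j) = (if i = j then 1 else 0)"
    and v: "v \<in> cpoly.span (\<Lambda> ` I)"
  shows "v = (\<Sum>i\<in>I. cscale (act v (p i)) (\<Lambda> i))"
proof -
  define F where "F v = (\<Sum>i\<in>I. cscale (act v (p i)) (\<Lambda> i))" for v
  have "F (\<Lambda> j) = \<Lambda> j" if "j \<in> I" for j
  proof -
    have "F (\<Lambda> j) = (\<Sum>i\<in>I. if j = i then \<Lambda> i else 0)"
      unfolding F_def using dual that by (intro sum.cong) auto
    then show ?thesis
      using I that by simp
  qed
  moreover have "F 0 = 0" "F (u + v) = F u + F v" "F (cscale c u) = cscale c (F u)" for c u v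
    by (simp_all add: F_def act_zero_left act_add_left act_cscale_left cpoly.scale_left_distrib
        sum.distrib cpoly.scale_sum_right)
  ultimately have "cpoly.span (\<Lambda> ` I) \<subseteq> {v. F v = v}"
    by (intro cpoly.span_minimal) (auto simp: cpoly.subspace_def)
  then show ?thesis
    using v by (auto simp: F_def)
qed

lemma dual_inj_on:
  assumes dual: "\<And>i j. i \<in> I \<Longrightarrow> j \<in> I \<Longrightarrow> act (\<Lambda> i) (p j) = (if i = j then 1 else 0)"
  shows "inj_on \<Lambda> I"
  using dual by (metis inj_onI zero_neq_one)

lemma dual_independent:
  assumes I: "finite I"
    and dual: "\<And>i j. i \<in> I \<Longrightarrow> j \<in> I \<Longrightarrow> act (\<Lambda> i) (p j) = (if i = j then 1 else 0)"
  shows "cpoly.independent (\<Lambda> ` I)"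
proof (rule cpoly.independent_if_scalars_zero)
  fix c w
  assume 0: "(\<Sum>w\<in>\<Lambda> ` I. cscale (c w) w) = 0" and "w \<in> \<Lambda> ` I"
  then obtain j where j: "j \<in> I" "w = \<Lambda> j"
    by blast
  have "0 = act (\<Sum>w\<in>\<Lambda> ` I. cscale (c w) w) (p j)"
    by (simp add: 0 act_zero_left)
  also have "\<dots> = (\<Sum>i\<in>I. c (\<Lambda> i) * act (\<Lambda> i) (p j))"
    using dual_inj_on[OF dual] by (simp add: sum.reindex act_sum_left act_cscale_left)
  also have "\<dots> = (\<Sum>i\<in>I. if i = j then c (\<Lambda> i) else 0)"
    using dual j(1) by (intro sum.cong) auto
  finally show "c w = 0"
    using I j by simp
qed (use I in simp)

lemma independent_spans_if_card_ge:
  assumes "finite T" "cpoly.independent S" "S \<subseteq> cpoly.span T" "card T \<le> card S"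
  shows "cpoly.span S = cpoly.span T"
proof
  show "cpoly.span S \<subseteq> cpoly.span T"
    using assms(3) by (intro cpoly.span_minimal) auto
  show "cpoly.span T \<subseteq> cpoly.span S"
  proof (rule ccontr)
    assume "\<not> cpoly.span T \<subseteq> cpoly.span S"
    then obtain v where v: "v \<in> cpoly.span T" "v \<notin> cpoly.span S"
      by blast
    then have "cpoly.independent (insert v S)"
      using assms(2) by (intro cpoly.independent_insertI)
    then have "finite (insert v S)" "card (insert v S) \<le> card T"
      using cpoly.independent_span_bound[OF assms(1), of "insert v S"] v(1) assms(3) by auto
    moreover have "v \<notin> S"
      using v(2) cpoly.span_base by blast
    ultimately show False
      using assms(4) by simp
  qed
qed

text \<open>
  Conversely to the coordinate functionals above: if the \<open>i\<close>-th member of a dual basis has degree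
  at most that of its monomial, then the monomials of degree at most \<open>t\<close> pair perfectly with
  the functionals of \<open>D\<close> of degree at most \<open>t\<close>. To reduce \<open>p\<close>, its components along all basis
  monomials are subtracted: what remains lies in \<open>D\<^sup>\<bottom>\<close>, and the components of degree greater
  than \<open>t\<close> may be put back because they lie in \<open>\<mm>\<^sup>t\<^sup>+\<^sup>1\<close>.
\<close>

lemma quotient_basis_of_graded_dual_basis:
  fixes \<beta> :: "'i \<Rightarrow> 'n::{finite,linorder} expo"
  assumes I: "finite I" "inj_on \<beta> I"
    and dual: "\<And>i j. i \<in> I \<Longrightarrow> j \<in> I \<Longrightarrow> act (\<Lambda> i) (mon (\<beta> j)) = (if i = j then 1 else 0)"
    and deg: "\<And>i. i \<in> I \<Longrightarrow> \<Lambda> i \<in> cpoly_upto (mdeg (\<beta> i))"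
  shows "quotient_basis (subspace_sum (perp (cpoly.span (\<Lambda> ` I))) (cpoly_from (t + 1)))
    (mon ` {\<alpha> \<in> \<beta> ` I. mdeg \<alpha> \<le> t})"
proof -
  define W where "W = subspace_sum (perp (cpoly.span (\<Lambda> ` I))) (cpoly_from (t + 1))"
  have W: "cpoly.subspace W"
    unfolding W_def by (intro subspace_subspace_sum subspace_perp subspace_cpoly_from)
  define K where "K = {i \<in> I. mdeg (\<beta> i) \<le> t}"
  have K: "{\<alpha> \<in> \<beta> ` I. mdeg \<alpha> \<le> t} = \<beta> ` K" "finite K" "K \<subseteq> I" "inj_on \<beta> K"
    using I by (auto simp: K_def intro: inj_on_subset)
  have act_sum: "act (\<Lambda> j) (\<Sum>i\<in>J. cscale (c i) (mon (\<beta> i))) = (if j \<in> J then c j else 0)"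
    if "j \<in> I" "J \<subseteq> I" for c j J
  proof -
    have "act (\<Lambda> j) (\<Sum>i\<in>J. cscale (c i) (mon (\<beta> i))) = (\<Sum>i\<in>J. if j = i then c i else 0)"
      unfolding act_sum_right act_cscale_right using dual that by (intro sum.cong) auto
    then show ?thesis
      using finite_subset[OF that(2) I(1)] by simp
  qed
  have "c \<alpha> = 0" if c: "(\<Sum>\<alpha>\<in>\<beta> ` K. cscale (c \<alpha>) (mon \<alpha>)) \<in> W" and \<alpha>: "\<alpha> \<in> \<beta> ` K" for c \<alpha>
  proof -
    obtain j where j: "j \<in> K" "\<alpha> = \<beta> j"
      using \<alpha> by blast
    then have upto: "j \<in> I" "\<Lambda> j \<in> cpoly_upto t"
      using deg by (force simp: K_def cpoly_upto_def)+
    obtain u w where uw: "(\<Sum>\<alpha>\<in>\<beta> ` K. cscale (c \<alpha>) (mon \<alpha>)) = u + w"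
        "u \<in> perp (cpoly.span (\<Lambda> ` I))" "w \<in> cpoly_from (t + 1)"
      using c unfolding W_def subspace_sum_def by blast
    have "act (\<Lambda> j) u = 0"
      using uw(2) upto(1) cpoly.span_base[of "\<Lambda> j" "\<Lambda> ` I"] by (auto simp: perp_def)
    then have "act (\<Lambda> j) (\<Sum>\<alpha>\<in>\<beta> ` K. cscale (c \<alpha>) (mon \<alpha>)) = 0"
      using act_eq_0_if_upto_from[OF upto(2) uw(3)] by (simp add: uw(1) act_add_right)
    then show ?thesis
      using act_sum[OF upto(1) K(3), of "\<lambda>i. c (\<beta> i)"] K(4) j by (simp add: sum.reindex)
  qed
  moreover have "\<exists>c. p - (\<Sum>\<alpha>\<in>\<beta> ` K. cscale (c \<alpha>) (mon \<alpha>)) \<in> W" for p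
  proof -
    define m where "m i = cscale (act (\<Lambda> i) p) (mon (\<beta> i))" for i
    have "p - (\<Sum>i\<in>I. m i) \<in> perp (cpoly.span (\<Lambda> ` I))"
      unfolding perp_def
      by (clarify, erule act_span_eq_0) (auto simp: m_def act_diff_right act_sum)
    moreover have "(\<Sum>i\<in>I - K. m i) \<in> cpoly_from (t + 1)"
      by (intro cpoly.subspace_sum subspace_cpoly_from)
         (auto simp: m_def K_def cpoly_from_def in_keys_iff lookup_mon when_def split: if_splits)
    ultimately have "(p - (\<Sum>i\<in>I. m i)) + (\<Sum>i\<in>I - K. m i) \<in> W"
      unfolding W_def subspace_sum_def by blast
    also have "(\<Sum>i\<in>I. m i) = (\<Sum>i\<in>I - K. m i) + (\<Sum>i\<in>K. m i)"
      using I(1) K(3) by (intro sum.subset_diff)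
    finally have "p - (\<Sum>i\<in>K. m i) \<in> W"
      by (simp add: algebra_simps)
    moreover have "(\<Sum>\<alpha>\<in>\<beta> ` K. cscale (act (\<Lambda> (the_inv_into K \<beta> \<alpha>)) p) (mon \<alpha>)) = (\<Sum>i\<in>K. m i)"
      using K(4) by (simp add: sum.reindex m_def the_inv_into_f_f)
    ultimately show ?thesis
      by metis
  qed
  ultimately show ?thesis
    using K(2) unfolding K(1) W_def[symmetric] by (auto simp: quotient_basis_mon_iff[OF W])
qed

section \<open>Derivatives and degrees\<close>

lemma cpoly_upto_0: "v \<in> cpoly_upto 0 \<Longrightarrow> v = cscale (lookup v 0) 1"
  by (rule poly_mapping_eqI) (auto simp: cpoly_upto_def lookup_one in_keys_iff when_def)

lemma pdiff_cpoly_upto: "v \<in> cpoly_upto t \<Longrightarrow> t \<le> mdeg \<gamma> \<Longrightarrow> lookup (pdiff k v) \<gamma> = 0"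
  by (force simp: lookup_pdiff cpoly_upto_def in_keys_iff)

lemma cpoly_upto_if_pdiff:
  assumes "\<And>k \<gamma>. t \<le> mdeg \<gamma> \<Longrightarrow> lookup (pdiff k v) \<gamma> = 0"
  shows "v \<in> cpoly_upto t"
  unfolding cpoly_upto_def
proof (safe, rule ccontr)
  fix \<alpha>
  assume \<alpha>: "\<alpha> \<in> keys v" "\<not> mdeg \<alpha> \<le> t"
  then have "\<alpha> \<noteq> 0"
    by auto
  then obtain k \<gamma> where \<gamma>: "\<alpha> = \<gamma> + ev k"
    by (rule expo_nonzero_obtains)
  then have "lookup (pdiff k v) \<gamma> = 0"
    using \<alpha> assms by simp
  then have "of_nat (Suc (lookup \<gamma> k)) * lookup v \<alpha> = 0"
    by (simp add: lookup_pdiff \<gamma>)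
  then show False
    using \<alpha>(1) by (simp add: in_keys_iff del: of_nat_Suc)
qed

text \<open>Repeated differentiation of a nonzero element ends in a nonzero constant.\<close>

lemma one_mem_if_pdiff_stable:
  assumes D: "cpoly.subspace (D :: 'n::finite cpoly set)" "\<And>k v. v \<in> D \<Longrightarrow> pdiff k v \<in> D"
    and v: "v \<in> D" "v \<noteq> 0" "v \<in> cpoly_upto t"
  shows "1 \<in> D"
  using v
proof (induction t arbitrary: v)
  case 0
  define c where "c = lookup v 0"
  have v: "v = cscale c 1"
    unfolding c_def by (rule cpoly_upto_0) (fact 0(3))
  then have "c \<noteq> 0"
    using 0(2) by auto
  then have "cscale (inverse c) v = 1"
    by (simp add: v)
  then show ?case
    using cpoly.subspace_scale[OF D(1) 0(1), of "inverse c"] by simp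
next
  case (Suc t)
  show ?case
  proof (cases "\<exists>k. pdiff k v \<noteq> 0")
    case True
    then obtain k where k: "pdiff k v \<noteq> 0" by blast
    have "pdiff k v \<in> cpoly_upto t"
      unfolding cpoly_upto_def
    proof (safe, rule ccontr)
      fix \<gamma>
      assume "\<gamma> \<in> keys (pdiff k v)" "\<not> mdeg \<gamma> \<le> t"
      then show False
        using pdiff_cpoly_upto[OF Suc.prems(3), of \<gamma> k] by (simp add: in_keys_iff)
    qed
    then show ?thesis
      using Suc.IH[of "pdiff k v"] k D(2) Suc.prems(1) by blast
  next
    case False
    then have "v \<in> cpoly_upto 0"
      by (intro cpoly_upto_if_pdiff) simp
    then have "v \<in> cpoly_upto t"
      by (auto simp: cpoly_upto_def)
    then show ?thesis
      using Suc.IH Suc.prems by blast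
  qed
qed

section \<open>Integration\<close>

lemma lookup_trunc: "lookup (trunc k \<Lambda>) \<alpha> = (if \<forall>l>k. lookup \<alpha> l = 0 then lookup \<Lambda> \<alpha> else 0)"
proof -
  define A where "A = {\<alpha> \<in> keys \<Lambda>. \<forall>l>k. lookup \<alpha> l = 0}"
  have "finite A"
    unfolding A_def by simp
  then have "lookup (trunc k \<Lambda>) \<alpha> = (if \<alpha> \<in> A then lookup \<Lambda> \<alpha> else 0)"
    by (simp add: trunc_def lookup_sum lookup_single when_def flip: A_def)
  then show ?thesis
    by (simp add: A_def in_keys_iff)
qed

lemma lookup_integ:
  "lookup (integ k \<Lambda>) \<alpha> =
    (if lookup \<alpha> k \<noteq> 0 \<and> (\<forall>l>k. lookup \<alpha> l = 0)
     then lookup \<Lambda> (\<alpha> - ev k) / of_nat (lookup \<alpha> k) else 0)"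
proof -
  have integ: "var k dvd integ k \<Lambda>" "pdiff k (integ k \<Lambda>) = trunc k \<Lambda>"
    using theI'[OF integ_ex1[of k \<Lambda>]] by (simp_all add: integ_def)
  show ?thesis
  proof (cases "lookup \<alpha> k = 0")
    case True
    then show ?thesis
      using integ(1) by (auto simp: dvd_def lookup_var_mult)
  next
    case False
    define \<gamma> where "\<gamma> = \<alpha> - ev k"
    have \<alpha>: "\<alpha> = \<gamma> + ev k"
      unfolding \<gamma>_def by (rule expo_minus_ev[OF False])
    have "of_nat (lookup \<alpha> k) * lookup (integ k \<Lambda>) \<alpha> = lookup (trunc k \<Lambda>) \<gamma>"
      unfolding integ(2)[symmetric] lookup_pdiff by (simp add: \<alpha> lookup_add lookup_ev)
    moreover have "(\<forall>l>k. lookup \<gamma> l = 0) \<longleftrightarrow> (\<forall>l>k. lookup \<alpha> l = 0)"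
      by (auto simp: \<alpha> lookup_add lookup_ev when_def)
    moreover have "of_nat (lookup \<alpha> k) \<noteq> (0 :: complex)"
      using False by simp
    ultimately show ?thesis
      using False
      by (cases "\<forall>l>k. lookup \<alpha> l = 0") (auto simp: lookup_trunc field_simps simp flip: \<gamma>_def)
  qed
qed

lemma integ_sum_cscale:
  "integ k (\<Sum>j\<in>J. cscale (c j) (\<Lambda> j)) = (\<Sum>j\<in>J. cscale (c j) (integ k (\<Lambda> j)))"
proof (rule poly_mapping_eqI)
  fix \<alpha>
  show "lookup (integ k (\<Sum>j\<in>J. cscale (c j) (\<Lambda> j))) \<alpha> =
      lookup (\<Sum>j\<in>J. cscale (c j) (integ k (\<Lambda> j))) \<alpha>"
    by (cases "lookup \<alpha> k \<noteq> 0 \<and> (\<forall>l>k. lookup \<alpha> l = 0)")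
       (simp_all only: lookup_integ lookup_sum lookup_cscale sum_divide_distrib, simp_all)
qed

text \<open>
  Each term of a polynomial other than the constant one is recovered by exactly one of the
  integrations, the one with respect to the last variable that occurs in the term.
\<close>

lemma lookup_sum_integ:
  fixes \<alpha> :: "'n::{finite,linorder} expo"
  assumes "\<alpha> \<noteq> 0"
  shows "\<exists>k. lookup \<alpha> k \<noteq> 0 \<and>
    (\<forall>\<Theta>. lookup (\<Sum>l\<in>UNIV. integ l (\<Theta> l)) \<alpha> = lookup (\<Theta> k) (\<alpha> - ev k) / of_nat (lookup \<alpha> k))"
proof -
  define k where "k = Max (keys \<alpha>)"
  have "keys \<alpha> \<noteq> {}"
    using assms by simp
  then have k: "lookup \<alpha> k \<noteq> 0"
    using Max_in[of "keys \<alpha>"] by (simp add: k_def in_keys_iff)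
  have "lookup \<alpha> l = 0" if "k < l" for l
    using Max_ge[of "keys \<alpha>" l] that by (auto simp: k_def in_keys_iff simp flip: not_less)
  then have "lookup \<alpha> l \<noteq> 0 \<and> (\<forall>l'>l. lookup \<alpha> l' = 0) \<longleftrightarrow> l = k" for l
    using k by (metis linorder_cases)
  then have "lookup (\<Sum>l\<in>UNIV. integ l (\<Theta> l)) \<alpha> = lookup (\<Theta> k) (\<alpha> - ev k) / of_nat (lookup \<alpha> k)"
    for \<Theta>
    by (simp add: lookup_sum lookup_integ)
  then show ?thesis
    using k by blast
qed

lemma sum_integ_pdiff:
  fixes \<Lambda> :: "'n::{finite,linorder} cpoly"
  assumes "lookup \<Lambda> 0 = 0"
  shows "(\<Sum>k\<in>UNIV. integ k (pdiff k \<Lambda>)) = \<Lambda>"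
proof (rule poly_mapping_eqI)
  fix \<alpha>
  show "lookup (\<Sum>k\<in>UNIV. integ k (pdiff k \<Lambda>)) \<alpha> = lookup \<Lambda> \<alpha>"
  proof (cases "\<alpha> = 0")
    case True
    then show ?thesis
      using assms by (simp add: lookup_sum lookup_integ)
  next
    case False
    obtain k where k: "lookup \<alpha> k \<noteq> 0"
      "\<And>\<Theta>. lookup (\<Sum>l\<in>UNIV. integ l (\<Theta> l)) \<alpha> = lookup (\<Theta> k) (\<alpha> - ev k) / of_nat (lookup \<alpha> k)"
      using lookup_sum_integ[OF False] by blast
    have "lookup (\<alpha> - ev k) k + 1 = lookup \<alpha> k"
      using k(1) by (simp add: lookup_minus lookup_ev)
    then show ?thesis
      using k(1) expo_minus_ev[OF k(1)] by (simp add: k(2) lookup_pdiff del: of_nat_add of_nat_Suc)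
  qed
qed

text \<open>
  The Poincare lemma for polynomials: a closed family is the gradient of its integral. If \<open>k\<close> is
  the last variable of a term, then that term is obtained from \<open>\<Theta> k\<close>, and closedness
  relates the coefficients of \<open>\<Theta> k\<close> and \<open>\<Theta> l\<close> from which it could be computed.
\<close>

lemma pdiff_sum_integ:
  fixes \<Theta> :: "'n::{finite,linorder} \<Rightarrow> 'n cpoly"
  assumes closed: "\<And>k l. k \<noteq> l \<Longrightarrow> pdiff l (\<Theta> k) = pdiff k (\<Theta> l)"
  shows "pdiff l (\<Sum>k\<in>UNIV. integ k (\<Theta> k)) = \<Theta> l"
proof (rule poly_mapping_eqI)
  fix \<gamma>
  define \<alpha> where "\<alpha> = \<gamma> + ev l"
  have \<alpha>_l: "lookup \<alpha> l = Suc (lookup \<gamma> l)"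
    by (simp add: \<alpha>_def lookup_add lookup_ev)
  then have "\<alpha> \<noteq> 0"
    by auto
  obtain k where k: "lookup \<alpha> k \<noteq> 0"
    "\<And>\<Theta>. lookup (\<Sum>l\<in>UNIV. integ l (\<Theta> l)) \<alpha> = lookup (\<Theta> k) (\<alpha> - ev k) / of_nat (lookup \<alpha> k)"
    using lookup_sum_integ[OF \<open>\<alpha> \<noteq> 0\<close>] by blast
  have "of_nat (lookup \<alpha> l) * lookup (\<Theta> k) (\<alpha> - ev k) = of_nat (lookup \<alpha> k) * lookup (\<Theta> l) \<gamma>"
  proof (cases "k = l")
    case True
    then show ?thesis
      by (simp add: \<alpha>_def)
  next
    case False
    then have "lookup \<gamma> k \<noteq> 0"
      using k(1) by (simp add: \<alpha>_def lookup_add lookup_ev)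
    then obtain \<delta> where \<delta>: "\<gamma> = \<delta> + ev k"
      by (rule that[OF expo_minus_ev])
    have "\<alpha> - ev k = \<delta> + ev l"
      unfolding \<alpha>_def \<delta> add.assoc add.commute[of "ev k"]
      unfolding add.assoc[symmetric] by (rule add_diff_cancel_right')
    moreover have "lookup \<alpha> l = lookup \<delta> l + 1" "lookup \<alpha> k = lookup \<delta> k + 1"
      using False by (simp_all add: \<alpha>_def \<delta> lookup_add lookup_ev)
    ultimately show ?thesis
      using arg_cong[OF closed[OF False], of "\<lambda>p. lookup p \<delta>"] by (simp add: lookup_pdiff \<delta>)
  qed
  then have "of_nat (lookup \<alpha> l) * (lookup (\<Theta> k) (\<alpha> - ev k) / of_nat (lookup \<alpha> k)) = lookup (\<Theta> l) \<gamma>"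
    using k(1) by (simp add: field_simps)
  then show "lookup (pdiff l (\<Sum>k\<in>UNIV. integ k (\<Theta> k))) \<gamma> = lookup (\<Theta> l) \<gamma>"
    using \<alpha>_l by (simp add: lookup_pdiff k(2) flip: \<alpha>_def)
qed

text \<open>
  The equations determine the derivatives of each \<open>\<Lambda> i\<close>, by induction on the degree \<open>h i\<close>: once the
  derivatives of the \<open>\<Lambda> j\<close> of lower degree are known, the quadratic equations say that
  the candidates for the derivatives of \<open>\<Lambda> i\<close> form a closed family.
\<close>

lemma pdiff_of_integration_equations:
  fixes \<Lambda> :: "'i \<Rightarrow> 'n::{finite,linorder} cpoly" and h :: "'i \<Rightarrow> nat"
  assumes I: "finite I"
    and const: "\<And>i. i \<in> I \<Longrightarrow> h i = 0 \<Longrightarrow> \<Lambda> i = 1"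
    and eq: "\<And>i. i \<in> I \<Longrightarrow> h i > 0 \<Longrightarrow>
      \<Lambda> i = (\<Sum>j | j \<in> I \<and> h j < h i. \<Sum>k\<in>UNIV. cscale (m i j k) (integ k (\<Lambda> j)))"
    and comm: "\<And>i s k l. i \<in> I \<Longrightarrow> s \<in> I \<Longrightarrow> h s < h i \<Longrightarrow> k \<noteq> l \<Longrightarrow>
      (\<Sum>j | j \<in> I \<and> h s < h j \<and> h j < h i. m i j k * m j s l - m i j l * m j s k) = 0"
    and "i \<in> I"
  shows "pdiff l (\<Lambda> i) = (\<Sum>j | j \<in> I \<and> h j < h i. cscale (m i j l) (\<Lambda> j))"
  using \<open>i \<in> I\<close>
proof (induction "h i" arbitrary: i l rule: less_induct)
  case less
  show ?case
  proof (cases "h i = 0")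
    case True
    then show ?thesis
      using const less.prems by (simp add: pdiff_one)
  next
    case False
    define J where "J i = {j \<in> I. h j < h i}" for i
    have "finite (J i)" for i
      using I by (simp add: J_def)
    define \<Theta> where "\<Theta> k = (\<Sum>j\<in>J i. cscale (m i j k) (\<Lambda> j))" for k
    define C where "C k l s = (\<Sum>j | j \<in> J i \<and> h s < h j. m i j k * m j s l)" for k l s
    have \<Theta>: "pdiff l (\<Theta> k) = (\<Sum>s\<in>I. cscale (C k l s) (\<Lambda> s))" for k l
    proof -
      have "pdiff l (\<Theta> k) = (\<Sum>j\<in>J i. cscale (m i j k) (\<Sum>s\<in>J j. cscale (m j s l) (\<Lambda> s)))"
        unfolding \<Theta>_def pdiff_sum pdiff_cscale
        using less.hyps by (intro sum.cong) (auto simp: J_def)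
      also have "\<dots> = (\<Sum>j\<in>J i. \<Sum>s | s \<in> I \<and> h s < h j. cscale (m i j k * m j s l) (\<Lambda> s))"
        by (simp add: cpoly.scale_sum_right J_def)
      also have "\<dots> = (\<Sum>s\<in>I. \<Sum>j | j \<in> J i \<and> h s < h j. cscale (m i j k * m j s l) (\<Lambda> s))"
        using I \<open>finite (J i)\<close> by (rule sum.swap_restrict[rotated])
      finally show ?thesis
        by (simp add: C_def cpoly.scale_sum_left)
    qed
    have "C k l s = C l k s" if "k \<noteq> l" "s \<in> I" for k l s
    proof -
      have J: "{j \<in> J i. h s < h j} = {j. j \<in> I \<and> h s < h j \<and> h j < h i}"
        by (auto simp: J_def)
      show ?thesis
      proof (cases "h s < h i")
        case True
        then show ?thesis
          using comm[OF less.prems that(2) True that(1)]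
          by (simp add: C_def J sum_subtractf)
      next
        case False
        then have empty: "{j. j \<in> I \<and> h s < h j \<and> h j < h i} = {}"
          by auto
        then show ?thesis
          unfolding C_def J empty by simp
      qed
    qed
    then have "pdiff l (\<Theta> k) = pdiff k (\<Theta> l)" if "k \<noteq> l" for k l
      unfolding \<Theta> using that by (intro sum.cong) auto
    then have "pdiff l (\<Sum>k\<in>UNIV. integ k (\<Theta> k)) = \<Theta> l"
      by (rule pdiff_sum_integ)
    moreover have "\<Lambda> i = (\<Sum>k\<in>UNIV. integ k (\<Theta> k))"
      unfolding \<Theta>_def integ_sum_cscale J_def
      using eq less.prems False by (subst sum.swap) simp
    ultimately show ?thesis
      by (simp add: \<Theta>_def J_def)
  qed
qed

lemma cpoly_upto_of_pdiff_expansion: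
  fixes \<Lambda> :: "'i \<Rightarrow> 'n::{finite,linorder} cpoly" and h :: "'i \<Rightarrow> nat"
  assumes pd: "\<And>i k. i \<in> I \<Longrightarrow> pdiff k (\<Lambda> i) = (\<Sum>j | j \<in> I \<and> h j < h i. cscale (m i j k) (\<Lambda> j))"
    and "i \<in> I"
  shows "\<Lambda> i \<in> cpoly_upto (h i)"
  using \<open>i \<in> I\<close>
proof (induction "h i" arbitrary: i rule: less_induct)
  case less
  have "lookup (pdiff k (\<Lambda> i)) \<gamma> = 0" if "h i \<le> mdeg \<gamma>" for k \<gamma>
  proof -
    have "lookup (\<Lambda> j) \<gamma> = 0" if "j \<in> I" "h j < h i" for j
    proof -
      have "\<Lambda> j \<in> cpoly_upto (h j)"
        by (rule less.hyps[OF that(2,1)])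
      then have "act (\<Lambda> j) (mon \<gamma>) = 0"
        by (rule act_mon_eq_0[OF _ less_le_trans[OF that(2) \<open>h i \<le> mdeg \<gamma>\<close>]])
      then show ?thesis
        by (simp add: act_mon)
    qed
    then show ?thesis
      using less.prems by (simp add: pd lookup_sum)
  qed
  then show ?case
    by (rule cpoly_upto_if_pdiff)
qed

section \<open>The equations of a stable space\<close>

text \<open>
  A derivative of \<open>\<Lambda> i\<close> has smaller degree, so only the \<open>\<Lambda> j\<close> with smaller monomials
  occur in its expansion. Since differentiation is the transpose of multiplication, its
  coordinates are values of \<open>\<Lambda> i\<close>.
\<close>

lemma pdiff_dual_expansion:
  fixes \<beta> :: "'i \<Rightarrow> 'n::{finite,linorder} expo"
  assumes I: "finite I"
    and dual: "\<And>i j. i \<in> I \<Longrightarrow> j \<in> I \<Longrightarrow> act (\<Lambda> i) (mon (\<beta> j)) = (if i = j then 1 else 0)"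
    and deg: "\<And>i. i \<in> I \<Longrightarrow> \<Lambda> i \<in> cpoly_upto (mdeg (\<beta> i))"
    and stable: "\<And>i k. i \<in> I \<Longrightarrow> pdiff k (\<Lambda> i) \<in> cpoly.span (\<Lambda> ` I)"
    and "i \<in> I"
  shows "pdiff k (\<Lambda> i) =
    (\<Sum>j | j \<in> I \<and> mdeg (\<beta> j) < mdeg (\<beta> i). cscale (act (\<Lambda> i) (mon (\<beta> j + ev k))) (\<Lambda> j))"
proof -
  have "pdiff k (\<Lambda> i) = (\<Sum>j\<in>I. cscale (act (\<Lambda> i) (mon (\<beta> j + ev k))) (\<Lambda> j))"
    using dual_expansion[OF I dual stable[OF \<open>i \<in> I\<close>]] by (simp add: act_pdiff_mon)
  also have "\<dots> = (\<Sum>j | j \<in> I \<and> mdeg (\<beta> j) < mdeg (\<beta> i).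
      cscale (act (\<Lambda> i) (mon (\<beta> j + ev k))) (\<Lambda> j))"
  proof (intro sum.mono_neutral_right ballI)
    fix j
    assume "j \<in> I - {j. j \<in> I \<and> mdeg (\<beta> j) < mdeg (\<beta> i)}"
    then have "act (\<Lambda> i) (mon (\<beta> j + ev k)) = 0"
      using act_mon_eq_0[OF deg[OF \<open>i \<in> I\<close>], of "\<beta> j + ev k"] by auto
    then show "cscale (act (\<Lambda> i) (mon (\<beta> j + ev k))) (\<Lambda> j) = 0"
      by simp
  qed (use I in auto)
  finally show ?thesis .
qed

text \<open>
  The two products sum to the values at \<open>mon \<gamma>\<close> of the second derivatives of \<open>\<Lambda> i\<close> with respect
  to \<open>k\<close> and \<open>l\<close>, taken in the two possible orders. In the expansion of that value over all \<open>j\<close> of lower degree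
  than \<open>i\<close>, the terms missing from the sum vanish, since there \<open>\<gamma> + ev l\<close> exceeds the degree
  of \<open>\<Lambda> j\<close>.
\<close>

lemma act_commutation:
  fixes \<beta> :: "'i \<Rightarrow> 'n::{finite,linorder} expo"
  assumes I: "finite I"
    and deg: "\<And>i. i \<in> I \<Longrightarrow> \<Lambda> i \<in> cpoly_upto (mdeg (\<beta> i))"
    and pd: "\<And>k. pdiff k (\<Lambda> i) =
      (\<Sum>j | j \<in> I \<and> mdeg (\<beta> j) < mdeg (\<beta> i). cscale (act (\<Lambda> i) (mon (\<beta> j + ev k))) (\<Lambda> j))"
  shows "(\<Sum>j | j \<in> I \<and> mdeg \<gamma> < mdeg (\<beta> j) \<and> mdeg (\<beta> j) < mdeg (\<beta> i).
      act (\<Lambda> i) (mon (\<beta> j + ev k)) * act (\<Lambda> j) (mon (\<gamma> + ev l))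
      - act (\<Lambda> i) (mon (\<beta> j + ev l)) * act (\<Lambda> j) (mon (\<gamma> + ev k))) = 0"
proof -
  define C where "C k l = (\<Sum>j | j \<in> I \<and> mdeg \<gamma> < mdeg (\<beta> j) \<and> mdeg (\<beta> j) < mdeg (\<beta> i).
      act (\<Lambda> i) (mon (\<beta> j + ev k)) * act (\<Lambda> j) (mon (\<gamma> + ev l)))" for k l
  have C: "C k l = act (pdiff l (pdiff k (\<Lambda> i))) (mon \<gamma>)" for k l
  proof -
    have "act (pdiff l (pdiff k (\<Lambda> i))) (mon \<gamma>) =
      (\<Sum>j | j \<in> I \<and> mdeg (\<beta> j) < mdeg (\<beta> i).
        act (\<Lambda> i) (mon (\<beta> j + ev k)) * act (\<Lambda> j) (mon (\<gamma> + ev l)))"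
      unfolding act_pdiff_mon[of l] pd act_sum_left act_cscale_left ..
    also have "\<dots> = C k l"
      unfolding C_def
    proof (intro sum.mono_neutral_right ballI)
      fix j
      assume "j \<in> {j. j \<in> I \<and> mdeg (\<beta> j) < mdeg (\<beta> i)} -
        {j. j \<in> I \<and> mdeg \<gamma> < mdeg (\<beta> j) \<and> mdeg (\<beta> j) < mdeg (\<beta> i)}"
      then have "act (\<Lambda> j) (mon (\<gamma> + ev l)) = 0"
        using act_mon_eq_0[OF deg, of j "\<gamma> + ev l"] by auto
      then show "act (\<Lambda> i) (mon (\<beta> j + ev k)) * act (\<Lambda> j) (mon (\<gamma> + ev l)) = 0"
        by simp
    qed (use I in auto)
    finally show ?thesis
      by simp
  qed
  have "C k l - C l k = 0"
    unfolding C pdiff_commute[of l k] by simp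
  then show ?thesis
    unfolding C_def sum_subtractf .
qed

section \<open>The equations of the punctual Hilbert scheme\<close>

theorem theorem3p3:
  fixes r deg_B :: nat
    and \<beta> :: "nat \<Rightarrow> 'n::{finite,linorder} expo"
    and E :: "'n expo set"
    and D :: "'n cpoly set"
  assumes "1 \<le> r"
    and "E = \<beta> ` {1..r}"
    and "inj_on \<beta> {1..r}"
    and "\<beta> 1 = 0"
    and "\<And>i j. 1 \<le> i \<Longrightarrow> i \<le> j \<Longrightarrow> j \<le> r \<Longrightarrow> mdeg (\<beta> i) \<le> mdeg (\<beta> j)"
    and "division_closed E"
    and "deg_B = Max (mdeg ` E)"
    and "cpoly.subspace D"
    and "cpoly.dim D = r"
    and "D \<subseteq> cpoly_upto (r - 1)"
  shows
    "(D \<in> Hilb r \<and>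
      (\<forall>t\<in>{1..deg_B}.
        quotient_basis (subspace_sum (perp D) (ideal_power max_ideal (t + 1))) (mons_upto E t)))
    \<longleftrightarrow>
     (\<exists>(\<Lambda> :: nat \<Rightarrow> 'n cpoly) (\<mu> :: 'n expo \<Rightarrow> 'n expo \<Rightarrow> complex).
       (inj_on \<Lambda> {1..r} \<and> cpoly.independent (\<Lambda> ` {1..r}) \<and> cpoly.span (\<Lambda> ` {1..r}) = D) \<and>
       (\<forall>i\<in>{1..r}. \<forall>j\<in>{1..r}. act (\<Lambda> i) (mon (\<beta> j)) = (if i = j then 1 else 0)) \<and>
       (\<forall>i\<in>{1..r}. \<Lambda> i = (\<Sum>\<alpha> | mdeg \<alpha> < r. cscale (\<mu> (\<beta> i) \<alpha> / mfact \<alpha>) (mon \<alpha>))) \<and>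
       \<Lambda> 1 = 1 \<and>
       (\<forall>i\<in>{2..r}.
          \<Lambda> i = (\<Sum>j | j \<in> {1..r} \<and> mdeg (\<beta> j) < mdeg (\<beta> i).
                   \<Sum>k\<in>UNIV. cscale (\<mu> (\<beta> i) (\<beta> j + ev k)) (integ k (\<Lambda> j)))) \<and>
       (\<forall>i\<in>{1..r}. \<forall>s\<in>{1..r}. \<forall>k l. mdeg (\<beta> s) < mdeg (\<beta> i) \<longrightarrow> k \<noteq> l \<longrightarrow>
          (\<Sum>j | j \<in> {1..r} \<and> mdeg (\<beta> s) < mdeg (\<beta> j) \<and> mdeg (\<beta> j) < mdeg (\<beta> i).
             \<mu> (\<beta> i) (\<beta> j + ev k) * \<mu> (\<beta> j) (\<beta> s + ev l)
             - \<mu> (\<beta> i) (\<beta> j + ev l) * \<mu> (\<beta> j) (\<beta> s + ev k)) = 0) \<and>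
       (\<forall>i\<in>{1..r}. \<forall>j\<in>{1..r}. \<forall>k. mdeg (\<beta> j) < mdeg (\<beta> i) \<longrightarrow>
          (\<beta> i = \<beta> j + ev k \<longrightarrow> \<mu> (\<beta> i) (\<beta> j + ev k) = 1) \<and>
          (\<beta> j + ev k \<in> E \<and> \<beta> i \<noteq> \<beta> j + ev k \<longrightarrow> \<mu> (\<beta> i) (\<beta> j + ev k) = 0)))"
proof -
  define I where "I = {1..r}"
  have I: "finite I" "1 \<in> I" "inj_on \<beta> I" "E = \<beta> ` I" "card I = r"
    using assms(1-3) by (auto simp: I_def)
  then have "finite E"
    by simp
  have \<beta>_eq: "\<beta> i = \<beta> j \<longleftrightarrow> i = j" if "i \<in> I" "j \<in> I" for i j
    using I(3) that by (auto dest: inj_onD)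
  have deg_0: "mdeg (\<beta> i) = 0 \<longleftrightarrow> i = 1" if "i \<in> I" for i
    using \<beta>_eq[OF that I(2)] assms(4) by simp
  have mons: "mons_upto E t = mon ` {\<alpha> \<in> E. mdeg \<alpha> \<le> t}" for t
    by (auto simp: mons_upto_def)
  obtain T where T: "T \<subseteq> D" "cpoly.independent T" "D \<subseteq> cpoly.span T" "card T = r"
    using cpoly.basis_exists[of D] assms(9) by blast
  have span_T: "cpoly.span T = D"
    using T assms(8) by (intro cpoly.span_subspace)
  have "finite T"
    using T(4) assms(1) by (intro card_ge_0_finite) simp
  show ?thesis
    unfolding I_def[symmetric]
  proof
    assume L: "D \<in> Hilb r \<and> (\<forall>t\<in>{1..deg_B}.
      quotient_basis (subspace_sum (perp D) (ideal_power max_ideal (t + 1))) (mons_upto E t))"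
    have stable: "pdiff k v \<in> D" if "v \<in> D" for k v
      using L that by (auto simp: Hilb_def)
    have "\<not> D \<subseteq> {0}"
    proof
      assume "D \<subseteq> {0}"
      then have "T = {}"
        using T(1,2) cpoly.dependent_zero[of T] by blast
      then show False
        using T(4) assms(1) by simp
    qed
    then obtain v where "v \<in> D" "v \<noteq> 0"
      by blast
    then have one: "1 \<in> D"
      using one_mem_if_pdiff_stable[OF assms(8) stable] assms(10) by blast
    \<comment> \<open>The quotients with \<open>t \<ge> 1\<close> supply the members of positive degree only; for \<open>\<beta> 1 = 0\<close> the
      functional is the constant \<open>1\<close>, which lies in \<open>D\<close> by stability.\<close>
    have "\<exists>v. v \<in> D \<and> v \<in> cpoly_upto (mdeg (\<beta> i)) \<and>
        (\<forall>j\<in>I. act v (mon (\<beta> j)) = (if i = j then 1 else 0))" if i: "i \<in> I" for i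
    proof (cases "i = 1")
      case True
      have "1 \<in> cpoly_upto (mdeg (\<beta> i))"
        by (auto simp: cpoly_upto_def)
      moreover have "act 1 (mon (\<beta> j)) = (if i = j then 1 else 0)" if "j \<in> I" for j
        using \<beta>_eq[OF i that] True assms(4) by (auto simp: act_one_mon)
      ultimately show ?thesis
        using one by blast
    next
      case False
      define t where "t = mdeg (\<beta> i)"
      have "\<beta> i \<in> E"
        using i I(4) by simp
      then have "t \<le> deg_B"
        unfolding t_def assms(7) using \<open>finite E\<close> by (intro Max_ge) auto
      moreover have "t \<noteq> 0"
        using deg_0[OF i] False unfolding t_def by blast
      ultimately have "t \<in> {1..deg_B}"
        by simp
      then have qb: "quotient_basis (subspace_sum (perp D) (cpoly_from (t + 1)))
          (mon ` {\<alpha> \<in> E. mdeg \<alpha> \<le> t})"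
        using L by (simp add: ideal_power_max_ideal flip: mons)
      obtain v where v: "v \<in> D" "v \<in> cpoly_upto t"
        "\<And>\<alpha>. \<alpha> \<in> E \<Longrightarrow> mdeg \<alpha> \<le> t \<Longrightarrow> act v (mon \<alpha>) = (if \<alpha> = \<beta> i then 1 else 0)"
        using coordinate_functional[OF \<open>finite T\<close> _ _ qb[folded span_T], of "\<beta> i"]
          \<open>finite E\<close> \<open>\<beta> i \<in> E\<close> by (auto simp: span_T t_def)
      \<comment> \<open>Duality with the monomials of higher degree is automatic from the degree of \<open>v\<close>.\<close>
      have "act v (mon (\<beta> j)) = (if i = j then 1 else 0)" if j: "j \<in> I" for j
      proof (cases "mdeg (\<beta> j) \<le> t")
        case True
        then show ?thesis
          using v(3)[of "\<beta> j"] \<beta>_eq[OF i j] j I(4) by auto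
      next
        case False
        then show ?thesis
          using act_mon_eq_0[OF v(2), of "\<beta> j"] by (auto simp: t_def)
      qed
      then show ?thesis
        using v(1,2) unfolding t_def by blast
    qed
    then obtain \<Lambda> where \<Lambda>: "\<And>i. i \<in> I \<Longrightarrow> \<Lambda> i \<in> D"
      "\<And>i. i \<in> I \<Longrightarrow> \<Lambda> i \<in> cpoly_upto (mdeg (\<beta> i))"
      "\<And>i j. i \<in> I \<Longrightarrow> j \<in> I \<Longrightarrow> act (\<Lambda> i) (mon (\<beta> j)) = (if i = j then 1 else 0)"
      by metis
    have indep: "inj_on \<Lambda> I" "cpoly.independent (\<Lambda> ` I)"
      using dual_inj_on[OF \<Lambda>(3)] dual_independent[OF I(1) \<Lambda>(3)] by blast+
    have span: "cpoly.span (\<Lambda> ` I) = D"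
      unfolding span_T[symmetric]
      by (rule independent_spans_if_card_ge[OF \<open>finite T\<close> indep(2)])
         (use \<Lambda>(1) indep(1) T(4) I(5) in \<open>auto simp: span_T card_image\<close>)
    define \<mu> where "\<mu> b \<alpha> = act (\<Lambda> (the_inv_into I \<beta> b)) (mon \<alpha>)" for b \<alpha>
    have \<mu>: "\<mu> (\<beta> i) \<alpha> = act (\<Lambda> i) (mon \<alpha>)" if "i \<in> I" for i \<alpha>
      using I(3) that by (simp add: \<mu>_def the_inv_into_f_f)
    have pd: "pdiff k (\<Lambda> i) = (\<Sum>j | j \<in> I \<and> mdeg (\<beta> j) < mdeg (\<beta> i).
        cscale (act (\<Lambda> i) (mon (\<beta> j + ev k))) (\<Lambda> j))" if "i \<in> I" for i k
      using pdiff_dual_expansion[OF I(1) \<Lambda>(3) \<Lambda>(2) _ that] stable[OF \<Lambda>(1)] unfolding span by blast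
    have one_eq: "\<Lambda> 1 = 1"
    proof -
      have "lookup (\<Lambda> 1) 0 = 1"
        using \<Lambda>(3)[OF I(2) I(2)] assms(4) by (simp add: act_mon mfact_def)
      moreover have "\<Lambda> 1 \<in> cpoly_upto 0"
        using \<Lambda>(2)[OF I(2)] assms(4) by simp
      ultimately show ?thesis
        using cpoly_upto_0[of "\<Lambda> 1"] by simp
    qed
    have coeffs: "\<Lambda> i = (\<Sum>\<alpha> | mdeg \<alpha> < r. cscale (\<mu> (\<beta> i) \<alpha> / mfact \<alpha>) (mon \<alpha>))" if "i \<in> I" for i
    proof (rule poly_mapping_eqI)
      fix \<gamma>
      have "lookup (\<Lambda> i) \<gamma> = 0" if "\<not> mdeg \<gamma> < r"
      proof -
        have "\<Lambda> i \<in> cpoly_upto (r - 1)"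
          using \<Lambda>(1)[OF \<open>i \<in> I\<close>] assms(10) by blast
        then have "act (\<Lambda> i) (mon \<gamma>) = 0"
          by (rule act_mon_eq_0) (use that assms(1) in simp)
        then show ?thesis
          by (simp add: act_mon)
      qed
      then show "lookup (\<Lambda> i) \<gamma> =
          lookup (\<Sum>\<alpha> | mdeg \<alpha> < r. cscale (\<mu> (\<beta> i) \<alpha> / mfact \<alpha>) (mon \<alpha>)) \<gamma>"
        by (simp add: finite_mdeg_less lookup_sum lookup_mon when_def \<mu>[OF that] act_mon if_distrib cong: if_cong)
    qed
    have integration: "\<Lambda> i = (\<Sum>j | j \<in> I \<and> mdeg (\<beta> j) < mdeg (\<beta> i).
        \<Sum>k\<in>UNIV. cscale (\<mu> (\<beta> i) (\<beta> j + ev k)) (integ k (\<Lambda> j)))" if i: "i \<in> {2..r}" for i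
    proof -
      have i': "i \<in> I" "i \<noteq> 1"
        using i by (auto simp: I_def)
      have "lookup (\<Lambda> i) 0 = 0"
        using \<Lambda>(3)[OF i'(1) I(2)] i'(2) assms(4) by (simp add: act_mon)
      then have "\<Lambda> i = (\<Sum>k\<in>UNIV. integ k (pdiff k (\<Lambda> i)))"
        by (simp add: sum_integ_pdiff)
      also have "\<dots> = (\<Sum>k\<in>UNIV. \<Sum>j | j \<in> I \<and> mdeg (\<beta> j) < mdeg (\<beta> i).
          cscale (\<mu> (\<beta> i) (\<beta> j + ev k)) (integ k (\<Lambda> j)))"
        unfolding pd[OF i'(1)] integ_sum_cscale \<mu>[OF i'(1)] ..
      also have "\<dots> = (\<Sum>j | j \<in> I \<and> mdeg (\<beta> j) < mdeg (\<beta> i).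
          \<Sum>k\<in>UNIV. cscale (\<mu> (\<beta> i) (\<beta> j + ev k)) (integ k (\<Lambda> j)))"
        by (rule sum.swap)
      finally show ?thesis .
    qed
    have commutation: "(\<Sum>j | j \<in> I \<and> mdeg (\<beta> s) < mdeg (\<beta> j) \<and> mdeg (\<beta> j) < mdeg (\<beta> i).
        \<mu> (\<beta> i) (\<beta> j + ev k) * \<mu> (\<beta> j) (\<beta> s + ev l)
        - \<mu> (\<beta> i) (\<beta> j + ev l) * \<mu> (\<beta> j) (\<beta> s + ev k)) = 0" if "i \<in> I" for i s k l
    proof -
      have "(\<Sum>j | j \<in> I \<and> mdeg (\<beta> s) < mdeg (\<beta> j) \<and> mdeg (\<beta> j) < mdeg (\<beta> i).
        \<mu> (\<beta> i) (\<beta> j + ev k) * \<mu> (\<beta> j) (\<beta> s + ev l)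
        - \<mu> (\<beta> i) (\<beta> j + ev l) * \<mu> (\<beta> j) (\<beta> s + ev k)) =
        (\<Sum>j | j \<in> I \<and> mdeg (\<beta> s) < mdeg (\<beta> j) \<and> mdeg (\<beta> j) < mdeg (\<beta> i).
        act (\<Lambda> i) (mon (\<beta> j + ev k)) * act (\<Lambda> j) (mon (\<beta> s + ev l))
        - act (\<Lambda> i) (mon (\<beta> j + ev l)) * act (\<Lambda> j) (mon (\<beta> s + ev k)))"
        by (intro sum.cong) (use \<mu> that in auto)
      also have "\<dots> = 0"
        by (rule act_commutation[OF I(1) \<Lambda>(2) pd[OF that]])
      finally show ?thesis .
    qed
    have "\<mu> (\<beta> i) \<alpha> = (if \<beta> i = \<alpha> then 1 else 0)" if i: "i \<in> I" and "\<alpha> \<in> E" for i \<alpha>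
    proof -
      obtain j where j: "j \<in> I" "\<alpha> = \<beta> j"
        using \<open>\<alpha> \<in> E\<close> I(4) by blast
      then show ?thesis
        using \<Lambda>(3)[OF i j(1)] \<beta>_eq[OF i j(1)] by (simp add: \<mu>[OF i])
    qed
    then have "(\<beta> i = \<beta> j + ev k \<longrightarrow> \<mu> (\<beta> i) (\<beta> j + ev k) = 1) \<and>
        (\<beta> j + ev k \<in> E \<and> \<beta> i \<noteq> \<beta> j + ev k \<longrightarrow> \<mu> (\<beta> i) (\<beta> j + ev k) = 0)"
      if "i \<in> I" for i j k
      using that I(4) by (metis imageI)
    then show "\<exists>\<Lambda> \<mu>. (inj_on \<Lambda> I \<and> cpoly.independent (\<Lambda> ` I) \<and> cpoly.span (\<Lambda> ` I) = D) \<and>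
       (\<forall>i\<in>I. \<forall>j\<in>I. act (\<Lambda> i) (mon (\<beta> j)) = (if i = j then 1 else 0)) \<and>
       (\<forall>i\<in>I. \<Lambda> i = (\<Sum>\<alpha> | mdeg \<alpha> < r. cscale (\<mu> (\<beta> i) \<alpha> / mfact \<alpha>) (mon \<alpha>))) \<and>
       \<Lambda> 1 = 1 \<and>
       (\<forall>i\<in>{2..r}.
          \<Lambda> i = (\<Sum>j | j \<in> I \<and> mdeg (\<beta> j) < mdeg (\<beta> i).
                   \<Sum>k\<in>UNIV. cscale (\<mu> (\<beta> i) (\<beta> j + ev k)) (integ k (\<Lambda> j)))) \<and>
       (\<forall>i\<in>I. \<forall>s\<in>I. \<forall>k l. mdeg (\<beta> s) < mdeg (\<beta> i) \<longrightarrow> k \<noteq> l \<longrightarrow>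
          (\<Sum>j | j \<in> I \<and> mdeg (\<beta> s) < mdeg (\<beta> j) \<and> mdeg (\<beta> j) < mdeg (\<beta> i).
             \<mu> (\<beta> i) (\<beta> j + ev k) * \<mu> (\<beta> j) (\<beta> s + ev l)
             - \<mu> (\<beta> i) (\<beta> j + ev l) * \<mu> (\<beta> j) (\<beta> s + ev k)) = 0) \<and>
       (\<forall>i\<in>I. \<forall>j\<in>I. \<forall>k. mdeg (\<beta> j) < mdeg (\<beta> i) \<longrightarrow>
          (\<beta> i = \<beta> j + ev k \<longrightarrow> \<mu> (\<beta> i) (\<beta> j + ev k) = 1) \<and>
          (\<beta> j + ev k \<in> E \<and> \<beta> i \<noteq> \<beta> j + ev k \<longrightarrow> \<mu> (\<beta> i) (\<beta> j + ev k) = 0))"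
      by (intro exI[of _ \<Lambda>] exI[of _ \<mu>] conjI ballI allI impI indep span \<Lambda>(3) coeffs one_eq
          integration commutation) auto
  next
    assume "\<exists>\<Lambda> \<mu>. (inj_on \<Lambda> I \<and> cpoly.independent (\<Lambda> ` I) \<and> cpoly.span (\<Lambda> ` I) = D) \<and>
       (\<forall>i\<in>I. \<forall>j\<in>I. act (\<Lambda> i) (mon (\<beta> j)) = (if i = j then 1 else 0)) \<and>
       (\<forall>i\<in>I. \<Lambda> i = (\<Sum>\<alpha> | mdeg \<alpha> < r. cscale (\<mu> (\<beta> i) \<alpha> / mfact \<alpha>) (mon \<alpha>))) \<and>
       \<Lambda> 1 = 1 \<and>
       (\<forall>i\<in>{2..r}.
          \<Lambda> i = (\<Sum>j | j \<in> I \<and> mdeg (\<beta> j) < mdeg (\<beta> i).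
                   \<Sum>k\<in>UNIV. cscale (\<mu> (\<beta> i) (\<beta> j + ev k)) (integ k (\<Lambda> j)))) \<and>
       (\<forall>i\<in>I. \<forall>s\<in>I. \<forall>k l. mdeg (\<beta> s) < mdeg (\<beta> i) \<longrightarrow> k \<noteq> l \<longrightarrow>
          (\<Sum>j | j \<in> I \<and> mdeg (\<beta> s) < mdeg (\<beta> j) \<and> mdeg (\<beta> j) < mdeg (\<beta> i).
             \<mu> (\<beta> i) (\<beta> j + ev k) * \<mu> (\<beta> j) (\<beta> s + ev l)
             - \<mu> (\<beta> i) (\<beta> j + ev l) * \<mu> (\<beta> j) (\<beta> s + ev k)) = 0) \<and>
       (\<forall>i\<in>I. \<forall>j\<in>I. \<forall>k. mdeg (\<beta> j) < mdeg (\<beta> i) \<longrightarrow>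
          (\<beta> i = \<beta> j + ev k \<longrightarrow> \<mu> (\<beta> i) (\<beta> j + ev k) = 1) \<and>
          (\<beta> j + ev k \<in> E \<and> \<beta> i \<noteq> \<beta> j + ev k \<longrightarrow> \<mu> (\<beta> i) (\<beta> j + ev k) = 0))"
    then obtain \<Lambda> :: "nat \<Rightarrow> 'n cpoly" and \<mu> where span: "cpoly.span (\<Lambda> ` I) = D"
      and dual': "\<forall>i\<in>I. \<forall>j\<in>I. act (\<Lambda> i) (mon (\<beta> j)) = (if i = j then 1 else 0)"
      and one: "\<Lambda> 1 = 1"
      and integration: "\<forall>i\<in>{2..r}. \<Lambda> i = (\<Sum>j | j \<in> I \<and> mdeg (\<beta> j) < mdeg (\<beta> i).
        \<Sum>k\<in>UNIV. cscale (\<mu> (\<beta> i) (\<beta> j + ev k)) (integ k (\<Lambda> j)))"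
      and commutation': "\<forall>i\<in>I. \<forall>s\<in>I. \<forall>k l. mdeg (\<beta> s) < mdeg (\<beta> i) \<longrightarrow> k \<noteq> l \<longrightarrow>
        (\<Sum>j | j \<in> I \<and> mdeg (\<beta> s) < mdeg (\<beta> j) \<and> mdeg (\<beta> j) < mdeg (\<beta> i).
          \<mu> (\<beta> i) (\<beta> j + ev k) * \<mu> (\<beta> j) (\<beta> s + ev l)
          - \<mu> (\<beta> i) (\<beta> j + ev l) * \<mu> (\<beta> j) (\<beta> s + ev k)) = 0"
      by (elim exE conjE) (rule that; assumption)
    have dual: "act (\<Lambda> i) (mon (\<beta> j)) = (if i = j then 1 else 0)" if "i \<in> I" "j \<in> I" for i j
      using dual' that by blast
    have commutation: "(\<Sum>j | j \<in> I \<and> mdeg (\<beta> s) < mdeg (\<beta> j) \<and> mdeg (\<beta> j) < mdeg (\<beta> i).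
        \<mu> (\<beta> i) (\<beta> j + ev k) * \<mu> (\<beta> j) (\<beta> s + ev l)
        - \<mu> (\<beta> i) (\<beta> j + ev l) * \<mu> (\<beta> j) (\<beta> s + ev k)) = 0"
      if "i \<in> I" "s \<in> I" "mdeg (\<beta> s) < mdeg (\<beta> i)" "k \<noteq> l" for i s k l
      using commutation' that by blast
    have pd: "pdiff k (\<Lambda> i) = (\<Sum>j | j \<in> I \<and> mdeg (\<beta> j) < mdeg (\<beta> i).
        cscale (\<mu> (\<beta> i) (\<beta> j + ev k)) (\<Lambda> j))" if "i \<in> I" for i k
    proof (rule pdiff_of_integration_equations[where h = "\<lambda>i. mdeg (\<beta> i)"
          and m = "\<lambda>i j k. \<mu> (\<beta> i) (\<beta> j + ev k)", OF I(1) _ _ commutation that])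
      fix i
      assume i: "i \<in> I"
      show "\<Lambda> i = 1" if "mdeg (\<beta> i) = 0"
        using deg_0[OF i] one that by simp
      have "i \<in> {2..r}" if "mdeg (\<beta> i) > 0"
        using deg_0[OF i] i that by (auto simp: I_def)
      then show "\<Lambda> i = (\<Sum>j | j \<in> I \<and> mdeg (\<beta> j) < mdeg (\<beta> i).
        \<Sum>k\<in>UNIV. cscale (\<mu> (\<beta> i) (\<beta> j + ev k)) (integ k (\<Lambda> j)))" if "mdeg (\<beta> i) > 0"
        using integration that by blast
    qed
    have "pdiff k v \<in> D" if "v \<in> D" for k v
    proof -
      have "pdiff k (\<Lambda> i) \<in> D" if "i \<in> I" for i
        unfolding pd[OF that] span[symmetric]
        by (intro cpoly.span_sum cpoly.span_scale cpoly.span_base) auto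
      then have "cpoly.span (\<Lambda> ` I) \<subseteq> {v. pdiff k v \<in> D}"
        using cpoly.subspace_0[OF assms(8)] cpoly.subspace_add[OF assms(8)]
          cpoly.subspace_scale[OF assms(8)]
        by (intro cpoly.span_minimal)
           (auto simp: cpoly.subspace_def pdiff_add pdiff_cscale pdiff_zero)
      then show ?thesis
        using that span by blast
    qed
    then have "D \<in> Hilb r"
      using assms(8-10) by (auto simp: Hilb_def)
    moreover have "\<Lambda> i \<in> cpoly_upto (mdeg (\<beta> i))" if "i \<in> I" for i
      using cpoly_upto_of_pdiff_expansion[where h = "\<lambda>i. mdeg (\<beta> i)"
          and m = "\<lambda>i j k. \<mu> (\<beta> i) (\<beta> j + ev k)", OF pd that] .
    then have "quotient_basis (subspace_sum (perp D) (cpoly_from (t + 1)))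
        (mon ` {\<alpha> \<in> E. mdeg \<alpha> \<le> t})" for t
      using quotient_basis_of_graded_dual_basis[OF I(1,3) dual] unfolding span I(4) by blast
    ultimately show "D \<in> Hilb r \<and> (\<forall>t\<in>{1..deg_B}.
      quotient_basis (subspace_sum (perp D) (ideal_power max_ideal (t + 1))) (mons_upto E t))"
      by (simp add: ideal_power_max_ideal mons)
  qed
qed

end
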